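(* (i) If $M$ is a closed $S_{L(H^{2})}$-invariant subspace of $L(H^{2})$, then there is an inner function $\theta\in H^{\infty}$ such that $$M=T_{\theta}M'=\{T_{\theta}T':T'\in M'\},$$ where $M'$ is a closed $S_{L(H^2)}$-invariant subspace of $L(H^2)$ and $H^{2}$ is generated by $\bigcup_{T\in M'}\{f\in H^2: f\in \text{range of } T\}$. (ii) Conversely, if $M\subset L(H^{2})$ satisfies $M=T_\theta M'=\{T_\theta T':T'\in M'\}$ for some inner function $\theta\in H^\infty$, where $M'$ is a closed $S_{L(H^2)}$-invariant subspace of $L(H^2)$ and $H^2$ is generated by $\bigcup_{T\in M'}\{f\in H^2: f\in \text{range of } T\}$, then $M$ is a closed invariant subspace for $S_{L(H^{2})}$.
   Context: $\mathbf{D}$ is the open unit disc in $\mathbb{C}$. $H^2$ is the Hardy space of analytic functions $f(z)=\sum_{n\ge 0}a_nz^n$ on $\mathbf{D}$ with $\sum_{n\ge 0}|a_n|^2<\infty$, a Hilbert space with inner product $(f,g)=\sum_n a_n\overline{b_n}$ for $f(z)=\sum a_nz^n$, $g(z)=\sum b_nz^n$. $L(H^2)$ is the Banach space of bounded linear operators on $H^2$ with the operator norm; "closed" in $L(H^2)$ means norm closed. $H^\infty$ is the Banach space of bounded analytic functions on $\mathbf{D}$ with the supremum norm. For $\phi\in H^\infty$, $T_\phi\in L(H^2)$ is given by $(T_\phi f)(z)=\phi(z)f(z)$. A function $\theta\in H^\infty$ is inner if its nontangential boundary values satisfy $|\theta(e^{it})|=1$ almost everywhere on $\partial\mathbf{D}$.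 $S\in L(H^2)$ is the shift $(Sf)(z)=zf(z)$, and $S_{L(H^2)}:L(H^2)\to L(H^2)$ is defined by $S_{L(H^2)}(T)=ST$. A subspace $M$ of $L(H^2)$ is $S_{L(H^2)}$-invariant if $ST\in M$ for all $T\in M$. $H^2$ is generated by a set $E\subset H^2$ if the closed linear span of $E$ is $H^2$.
   Formalization: In part (i) the subspace M is assumed to be different from {0}; for M = {0} the claim fails, since T_θ is injective for inner θ, so M' would be {0}, whose ranges do not generate H². *)

theory Defs
  imports "HOL-Complex_Analysis.Complex_Analysis"
begin

section \<open>The Hardy space\<close>

definition taylor_coeff :: "(complex \<Rightarrow> complex) \<Rightarrow> nat \<Rightarrow> complex" where
  "taylor_coeff f n = (deriv ^^ n) f 0 / fact n"

lemma taylor_coeff_sums: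
  assumes "f holomorphic_on ball 0 1" "z \<in> ball 0 1"
  shows "(\<lambda>n. taylor_coeff f n * z ^ n) sums f z"
  using holomorphic_power_series[OF assms] by (simp add: taylor_coeff_def)

lemma taylor_coeff_add:
  assumes "f holomorphic_on ball 0 1" "g holomorphic_on ball 0 1"
  shows "taylor_coeff (\<lambda>z. f z + g z) n = taylor_coeff f n + taylor_coeff g n"
  using higher_deriv_add[OF assms, of 0 n] by (simp add: taylor_coeff_def add_divide_distrib)

lemma taylor_coeff_cmult:
  assumes "f holomorphic_on ball 0 1"
  shows "taylor_coeff (\<lambda>z. c * f z) n = c * taylor_coeff f n"
  using higher_deriv_cmult[OF assms, of 0 n c] by (simp add: taylor_coeff_def)

lemma taylor_coeff_zero: "taylor_coeff (\<lambda>z. 0) n = 0"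
  by (simp add: taylor_coeff_def)

lemma taylor_coeff_cong:
  assumes "f holomorphic_on ball 0 1" "\<And>z. z \<in> ball 0 1 \<Longrightarrow> g z = f z"
  shows "taylor_coeff g n = taylor_coeff f n"
proof -
  have "g holomorphic_on ball 0 1"
    using assms holomorphic_cong by blast
  then have "(deriv ^^ n) g 0 = (deriv ^^ n) f 0"
    using assms by (intro higher_deriv_transform_within_open[of _ "ball 0 1"]) auto
  then show ?thesis
    by (simp add: taylor_coeff_def)
qed

lemma summable_mult_cnj:
  fixes a b :: "nat \<Rightarrow> complex"
  assumes "summable (\<lambda>n. (norm (a n))\<^sup>2)" "summable (\<lambda>n. (norm (b n))\<^sup>2)"
  shows "summable (\<lambda>n. a n * cnj (b n))"
proof (rule summable_comparison_test')
  show "summable (\<lambda>n. (norm (a n))\<^sup>2 + (norm (b n))\<^sup>2)"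
    using assms by (rule summable_add)
  show "norm (a n * cnj (b n)) \<le> (norm (a n))\<^sup>2 + (norm (b n))\<^sup>2" for n
  proof -
    have "2 * norm (a n) * norm (b n) \<le> (norm (a n))\<^sup>2 + (norm (b n))\<^sup>2"
      by (rule sum_squares_bound)
    moreover have "0 \<le> norm (a n) * norm (b n)" by simp
    ultimately have "norm (a n) * norm (b n) \<le> (norm (a n))\<^sup>2 + (norm (b n))\<^sup>2"
      by linarith
    then show ?thesis by (simp add: norm_mult)
  qed
qed

lemma summable_norm_add_sq:
  fixes a b :: "nat \<Rightarrow> complex"
  assumes "summable (\<lambda>n. (norm (a n))\<^sup>2)" "summable (\<lambda>n. (norm (b n))\<^sup>2)"
  shows "summable (\<lambda>n. (norm (a n + b n))\<^sup>2)"
proof (rule summable_comparison_test')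
  show "summable (\<lambda>n. 2 * ((norm (a n))\<^sup>2 + (norm (b n))\<^sup>2))"
    using assms by (intro summable_mult summable_add)
  show "norm ((norm (a n + b n))\<^sup>2) \<le> 2 * ((norm (a n))\<^sup>2 + (norm (b n))\<^sup>2)" for n
  proof -
    have "(norm (a n + b n))\<^sup>2 \<le> (norm (a n) + norm (b n))\<^sup>2"
      by (simp add: norm_triangle_ineq power_mono)
    also have "\<dots> \<le> 2 * ((norm (a n))\<^sup>2 + (norm (b n))\<^sup>2)"
      using sum_squares_bound[of "norm (a n)" "norm (b n)"] by (simp add: power2_sum)
    finally show ?thesis by simp
  qed
qed

text \<open>Elements of \<open>H\<^sup>2\<close> are total functions, normalised to be \<open>0\<close> outside the open unit disc so that
  equality in the type is equality of functions on the disc.\<close>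

typedef h2 = "{f :: complex \<Rightarrow> complex. f holomorphic_on ball 0 1 \<and>
    summable (\<lambda>n. (norm (taylor_coeff f n))\<^sup>2) \<and> (\<forall>z. z \<notin> ball 0 1 \<longrightarrow> f z = 0)}"
  morphisms h2_fun Abs_h2
  by (rule exI[of _ "\<lambda>z. 0"]) (simp add: taylor_coeff_zero)

setup_lifting type_definition_h2

definition h2_coeff :: "h2 \<Rightarrow> nat \<Rightarrow> complex" where
  "h2_coeff f n = taylor_coeff (h2_fun f) n"

lemma h2_fun_holomorphic: "h2_fun f holomorphic_on ball 0 1"
  using h2_fun by blast

lemma h2_fun_outside: "z \<notin> ball 0 1 \<Longrightarrow> h2_fun f z = 0"
  using h2_fun by blast

lemma summable_h2_coeff: "summable (\<lambda>n. (norm (h2_coeff f n))\<^sup>2)"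
  using h2_fun by (simp add: h2_coeff_def)

lemma h2_eqI:
  assumes "\<And>z. z \<in> ball 0 1 \<Longrightarrow> h2_fun f z = h2_fun g z"
  shows "f = g"
proof -
  have "h2_fun f = h2_fun g"
  proof
    show "h2_fun f z = h2_fun g z" for z
      using assms by (cases "z \<in> ball 0 1") (simp_all add: h2_fun_outside del: mem_ball)
  qed
  then show ?thesis by (simp add: h2_fun_inject)
qed

lift_definition h2_scaleC :: "complex \<Rightarrow> h2 \<Rightarrow> h2" is "\<lambda>c f z. c * f z"
  by (auto simp: taylor_coeff_cmult norm_mult power_mult_distrib
      intro!: holomorphic_intros summable_mult)

instantiation h2 :: real_vector
begin

lift_definition zero_h2 :: h2 is "\<lambda>z. 0"
  by (simp add: taylor_coeff_zero)

lift_definition plus_h2 :: "h2 \<Rightarrow> h2 \<Rightarrow> h2" is "\<lambda>f g z. f z + g z"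
  by (auto simp: taylor_coeff_add intro!: holomorphic_intros summable_norm_add_sq)

definition uminus_h2 :: "h2 \<Rightarrow> h2" where
  "- f = h2_scaleC (- 1) f"

definition minus_h2 :: "h2 \<Rightarrow> h2 \<Rightarrow> h2" where
  "f - g = f + (- g :: h2)"

definition scaleR_h2 :: "real \<Rightarrow> h2 \<Rightarrow> h2" where
  "r *\<^sub>R f = h2_scaleC (of_real r) f"

instance
proof
  fix a b c :: h2 and r s :: real
  show "a + b + c = a + (b + c)" by transfer (simp add: add.assoc)
  show "a + b = b + a" by transfer (simp add: add.commute)
  show "0 + a = a" by transfer simp
  show "- a + a = 0" unfolding uminus_h2_def by transfer simp
  show "a - b = a + - b" by (simp add: minus_h2_def)
  show "r *\<^sub>R (a + b) = r *\<^sub>R a + r *\<^sub>R b"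
    unfolding scaleR_h2_def by transfer (simp add: distrib_left)
  show "(r + s) *\<^sub>R a = r *\<^sub>R a + s *\<^sub>R a"
    unfolding scaleR_h2_def by transfer (simp add: distrib_right)
  show "r *\<^sub>R s *\<^sub>R a = (r * s) *\<^sub>R a"
    unfolding scaleR_h2_def by transfer (simp add: mult.assoc)
  show "1 *\<^sub>R a = a" unfolding scaleR_h2_def by transfer simp
qed

end

lemma h2_coeff_add: "h2_coeff (f + g) n = h2_coeff f n + h2_coeff g n"
  by (simp add: h2_coeff_def plus_h2.rep_eq taylor_coeff_add h2_fun_holomorphic)

lemma h2_coeff_scaleC: "h2_coeff (h2_scaleC c f) n = c * h2_coeff f n"
  by (simp add: h2_coeff_def h2_scaleC.rep_eq taylor_coeff_cmult h2_fun_holomorphic)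

lemma h2_eq_0_iff: "f = 0 \<longleftrightarrow> (\<forall>n. h2_coeff f n = 0)"
proof
  show "f = 0 \<Longrightarrow> \<forall>n. h2_coeff f n = 0"
    by (simp add: h2_coeff_def zero_h2.rep_eq taylor_coeff_zero)
  assume *: "\<forall>n. h2_coeff f n = 0"
  show "f = 0"
  proof (rule h2_eqI)
    fix z :: complex assume "z \<in> ball 0 1"
    from taylor_coeff_sums[OF h2_fun_holomorphic[of f] this] *
    have "(\<lambda>n. 0) sums h2_fun f z" by (simp add: h2_coeff_def)
    from sums_unique2[OF this sums_zero] show "h2_fun f z = h2_fun 0 z"
      by (simp add: zero_h2.rep_eq)
  qed
qed

definition h2_cinner :: "h2 \<Rightarrow> h2 \<Rightarrow> complex" where
  "h2_cinner f g = (\<Sum>n. h2_coeff f n * cnj (h2_coeff g n))"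

lemma summable_h2_cinner: "summable (\<lambda>n. h2_coeff f n * cnj (h2_coeff g n))"
  by (intro summable_mult_cnj summable_h2_coeff)

text \<open>The library has real inner product spaces only. The real part of the Hermitian inner product
  yields the same norm.\<close>

instantiation h2 :: real_inner
begin

definition inner_h2 :: "h2 \<Rightarrow> h2 \<Rightarrow> real" where
  "inner_h2 f g = Re (h2_cinner f g)"

definition norm_h2 :: "h2 \<Rightarrow> real" where
  "norm_h2 f = sqrt (inner f f)"

definition dist_h2 :: "h2 \<Rightarrow> h2 \<Rightarrow> real" where
  "dist_h2 f g = norm (f - g)"

definition sgn_h2 :: "h2 \<Rightarrow> h2" where
  "sgn_h2 f = inverse (norm f) *\<^sub>R f"

definition uniformity_h2 :: "(h2 \<times> h2) filter" where
  "uniformity_h2 = (INF e\<in>{0<..}. principal {(x, y). dist x y < e})"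

definition open_h2 :: "h2 set \<Rightarrow> bool" where
  "open_h2 U \<longleftrightarrow> (\<forall>x\<in>U. \<forall>\<^sub>F (x', y) in uniformity. x' = x \<longrightarrow> y \<in> U)"

instance
proof
  fix x y z :: h2 and r :: real and U :: "h2 set"
  have inner_eq: "inner f g = (\<Sum>n. Re (h2_coeff f n * cnj (h2_coeff g n)))" for f g :: h2
    unfolding inner_h2_def h2_cinner_def by (rule Re_suminf[OF summable_h2_cinner])
  have summ: "summable (\<lambda>n. Re (h2_coeff f n * cnj (h2_coeff g n)))" for f g :: h2
    by (rule summable_Re[OF summable_h2_cinner])
  have sq: "Re (h2_coeff f n * cnj (h2_coeff f n)) = (norm (h2_coeff f n))\<^sup>2" for f n
    by (simp add: complex_mult_cnj cmod_power2)
  show "dist x y = norm (x - y)" by (rule dist_h2_def)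
  show "sgn x = inverse (norm x) *\<^sub>R x" by (rule sgn_h2_def)
  show "(uniformity :: (h2 \<times> h2) filter) = (INF e\<in>{0<..}. principal {(x, y). dist x y < e})"
    by (rule uniformity_h2_def)
  show "open U \<longleftrightarrow> (\<forall>x\<in>U. \<forall>\<^sub>F (x', y) in uniformity. x' = x \<longrightarrow> y \<in> U)"
    by (rule open_h2_def)
  show "inner x y = inner y x"
    unfolding inner_eq by (simp add: mult.commute)
  show "inner (x + y) z = inner x z + inner y z"
    unfolding inner_eq h2_coeff_add distrib_right plus_complex.sel
    by (rule suminf_add[symmetric, OF summ summ])
  show "inner (r *\<^sub>R x) y = r * inner x y"
    unfolding inner_eq scaleR_h2_def h2_coeff_scaleC mult.assoc Re_complex_of_real
    using suminf_mult[OF summ[of x y], of r] by simp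
  show "0 \<le> inner x x"
    unfolding inner_eq sq by (simp add: suminf_nonneg summable_h2_coeff)
  show "inner x x = 0 \<longleftrightarrow> x = 0"
    unfolding inner_eq sq h2_eq_0_iff
    using suminf_eq_zero_iff[OF summable_h2_coeff[of x]] by simp
  show "norm x = sqrt (inner x x)" by (rule norm_h2_def)
qed

end

lemma norm_h2_sq: "(norm f)\<^sup>2 = (\<Sum>n. (norm (h2_coeff f n))\<^sup>2)"
proof -
  have "(norm f)\<^sup>2 = Re (h2_cinner f f)"
    by (simp add: power2_norm_eq_inner inner_h2_def)
  also have "\<dots> = (\<Sum>n. Re (h2_coeff f n * cnj (h2_coeff f n)))"
    unfolding h2_cinner_def by (rule Re_suminf[OF summable_h2_cinner])
  also have "\<dots> = (\<Sum>n. (norm (h2_coeff f n))\<^sup>2)"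
    by (simp add: complex_mult_cnj cmod_power2)
  finally show ?thesis .
qed

lemma norm_h2_scaleC: "norm (h2_scaleC c f) = norm c * norm f"
proof -
  have "(norm (h2_scaleC c f))\<^sup>2 = (norm c * norm f)\<^sup>2"
    unfolding power_mult_distrib norm_h2_sq
    by (simp add: h2_coeff_scaleC norm_mult power_mult_distrib suminf_mult summable_h2_coeff)
  then show ?thesis by (simp add: power2_eq_iff_nonneg)
qed

interpretation h2: vector_space h2_scaleC
  by unfold_locales (transfer; simp add: algebra_simps)+


section \<open>Bounded operators\<close>

text \<open>A complex-linear bounded operator is a bounded real-linear operator that commutes with complex
  scalars. The norm of type \<^typ>\<open>h2 \<Rightarrow>\<^sub>L h2\<close> is the operator norm, and \<open>L_H2\<close> below is norm closed
  in that type, so that a subset of \<open>L_H2\<close> is closed in \<open>L_H2\<close> iff it is closed in the type.\<close>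

definition L_H2 :: "(h2 \<Rightarrow>\<^sub>L h2) set" where
  "L_H2 = {T. \<forall>c f. blinfun_apply T (h2_scaleC c f) = h2_scaleC c (blinfun_apply T f)}"

lemma bounded_linear_h2_scaleC: "bounded_linear (h2_scaleC c)"
proof (rule bounded_linear_intro)
  show "h2_scaleC c (x + y) = h2_scaleC c x + h2_scaleC c y" for x y
    by (rule h2.scale_right_distrib)
  show "h2_scaleC c (r *\<^sub>R x) = r *\<^sub>R h2_scaleC c x" for r x
    unfolding scaleR_h2_def by (rule h2.scale_left_commute)
  show "norm (h2_scaleC c x) \<le> norm x * norm c" for x
    by (simp add: norm_h2_scaleC)
qed

lemma closed_L_H2: "closed L_H2"
proof -
  have "closed {T :: h2 \<Rightarrow>\<^sub>L h2.
      blinfun_apply T (h2_scaleC c f) = h2_scaleC c (blinfun_apply T f)}" for c f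
    by (intro closed_Collect_eq continuous_intros
        bounded_linear.continuous_on[OF bounded_linear_h2_scaleC])
  then have "closed (\<Inter>c. \<Inter>f. {T :: h2 \<Rightarrow>\<^sub>L h2.
      blinfun_apply T (h2_scaleC c f) = h2_scaleC c (blinfun_apply T f)})"
    by (intro closed_INT) auto
  also have "(\<Inter>c. \<Inter>f. {T :: h2 \<Rightarrow>\<^sub>L h2.
      blinfun_apply T (h2_scaleC c f) = h2_scaleC c (blinfun_apply T f)}) = L_H2"
    by (auto simp: L_H2_def)
  finally show ?thesis .
qed

lifting_forget h2.lifting

lift_definition op_scaleC :: "complex \<Rightarrow> (h2 \<Rightarrow>\<^sub>L h2) \<Rightarrow> (h2 \<Rightarrow>\<^sub>L h2)" is
  "\<lambda>c T f. h2_scaleC c (T f)"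
  by (rule bounded_linear_compose[OF bounded_linear_h2_scaleC])

interpretation op: vector_space op_scaleC
  by unfold_locales
    (auto intro!: blinfun_eqI simp: op_scaleC.rep_eq plus_blinfun.rep_eq
      h2.scale_right_distrib h2.scale_left_distrib)


section \<open>Multiplication operators\<close>

definition H_infinity :: "(complex \<Rightarrow> complex) set" where
  "H_infinity = {\<phi>. \<phi> holomorphic_on ball 0 1 \<and> bounded (\<phi> ` ball 0 1)}"

text \<open>For \<open>\<phi> \<in> H\<^sup>\<infinity>\<close> the lemma \<open>mult_op_apply\<close> below shows that this is a genuine bounded
  operator given by multiplication.\<close>

definition mult_op :: "(complex \<Rightarrow> complex) \<Rightarrow> (h2 \<Rightarrow>\<^sub>L h2)" where
  "mult_op \<phi> = Blinfun (\<lambda>f. Abs_h2 (\<lambda>z. if z \<in> ball 0 1 then \<phi> z * h2_fun f z else 0))"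

lemma has_integral_cis:
  "((\<lambda>t. cis (of_int k * t)) has_integral (if k = 0 then of_real (2 * pi) else 0)) {0..2 * pi}"
proof (cases "k = 0")
  case True
  then show ?thesis
    using has_integral_const_real[of "1::complex" 0 "2 * pi"] by (simp add: scaleR_conv_of_real)
next
  case False
  define F where "F t = cis (of_int k * t) / (\<i> * of_int k)" for t :: real
  have "((\<lambda>t. cis (of_int k * t)) has_integral (F (2 * pi) - F 0)) {0..2 * pi}"
  proof (rule fundamental_theorem_of_calculus)
    fix t :: real assume "t \<in> {0..2 * pi}"
    have "((\<lambda>w. exp (\<i> * of_int k * w) / (\<i> * of_int k)) has_field_derivative
        exp (\<i> * of_int k * of_real t)) (at (of_real t))"
      using False by (auto intro!: derivative_eq_intros)
    from has_vector_derivative_real_field[OF this]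
    show "(F has_vector_derivative cis (of_int k * t)) (at t within {0..2 * pi})"
      by (simp add: F_def[abs_def] cis_conv_exp mult.assoc)
  qed auto
  moreover have "cis (of_int k * (2 * pi)) = 1"
    using cis_multiple_2pi[of "of_int k"] by (simp add: mult.commute mult.left_commute)
  ultimately show ?thesis
    using False by (simp add: F_def)
qed

lemma parseval_poly:
  "((\<lambda>t. (norm (\<Sum>n<N. b n * cis (of_nat n * t)))\<^sup>2) has_integral
      2 * pi * (\<Sum>n<N. (norm (b n))\<^sup>2)) {0..2 * pi}"
proof -
  have eq: "complex_of_real ((norm (\<Sum>n<N. b n * cis (of_nat n * t)))\<^sup>2) =
      (\<Sum>n<N. \<Sum>m<N. b n * cnj (b m) * cis (of_int (int n - int m) * t))" for t
  proof -
    have "complex_of_real ((norm (\<Sum>n<N. b n * cis (of_nat n * t)))\<^sup>2) =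
      (\<Sum>n<N. b n * cis (of_nat n * t)) * (\<Sum>m<N. cnj (b m) * cnj (cis (of_nat m * t)))"
      by (simp only: complex_norm_square cnj_sum complex_cnj_mult)
    also have "\<dots> = (\<Sum>n<N. \<Sum>m<N. (b n * cis (of_nat n * t)) * (cnj (b m) * cnj (cis (of_nat m * t))))"
      by (rule sum_product)
    also have "\<dots> = (\<Sum>n<N. \<Sum>m<N. b n * cnj (b m) * cis (of_int (int n - int m) * t))"
    proof (intro sum.cong refl)
      fix n m
      have "cis (of_int (int n - int m) * t) = cis (of_nat n * t) * cnj (cis (of_nat m * t))"
        by (simp add: cis_cnj cis_mult algebra_simps)
      then show "(b n * cis (of_nat n * t)) * (cnj (b m) * cnj (cis (of_nat m * t))) =
          b n * cnj (b m) * cis (of_int (int n - int m) * t)" by simp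
    qed
    finally show ?thesis .
  qed
  have "((\<lambda>t. \<Sum>n<N. \<Sum>m<N. b n * cnj (b m) * cis (of_int (int n - int m) * t)) has_integral
      (\<Sum>n<N. \<Sum>m<N. b n * cnj (b m) * (if int n - int m = 0 then of_real (2 * pi) else 0))) {0..2 * pi}"
    by (intro has_integral_sum has_integral_mult_right has_integral_cis) auto
  also have "(\<Sum>n<N. \<Sum>m<N. b n * cnj (b m) * (if int n - int m = 0 then of_real (2 * pi) else 0)) =
      (\<Sum>n<N. of_real (2 * pi * (norm (b n))\<^sup>2))"
  proof (intro sum.cong refl)
    fix n assume "n \<in> {..<N}"
    have "(\<Sum>m<N. b n * cnj (b m) * (if int n - int m = 0 then of_real (2 * pi) else 0)) =
        (\<Sum>m<N. if n = m then b n * cnj (b n) * of_real (2 * pi) else 0)"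
      by (intro sum.cong) auto
    also have "\<dots> = b n * cnj (b n) * of_real (2 * pi)"
      using \<open>n \<in> {..<N}\<close> by simp
    also have "\<dots> = of_real (2 * pi * (norm (b n))\<^sup>2)"
      unfolding of_real_mult complex_norm_square by (simp add: mult_ac)
    finally show "(\<Sum>m<N. b n * cnj (b m) * (if int n - int m = 0 then of_real (2 * pi) else 0)) =
        complex_of_real (2 * pi * (norm (b n))\<^sup>2)" .
  qed
  finally have "((\<lambda>t. complex_of_real ((norm (\<Sum>n<N. b n * cis (of_nat n * t)))\<^sup>2)) has_integral
      of_real (2 * pi * (\<Sum>n<N. (norm (b n))\<^sup>2))) {0..2 * pi}"
    unfolding eq by (simp add: sum_distrib_left)
  from has_integral_linear[OF this bounded_linear_Re] show ?thesis
    by (simp add: o_def)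
qed

lemma parseval:
  assumes hol: "g holomorphic_on ball 0 1" and r: "0 < r" "r < 1"
  shows "(\<lambda>t. (norm (g (of_real r * cis t)))\<^sup>2) integrable_on {0..2 * pi}"
    and "(\<lambda>n. (norm (taylor_coeff g n))\<^sup>2 * r ^ (2 * n)) sums
           (integral {0..2 * pi} (\<lambda>t. (norm (g (of_real r * cis t)))\<^sup>2) / (2 * pi))"
proof -
  define b where "b n = taylor_coeff g n * of_real r ^ n" for n
  have term_eq: "taylor_coeff g n * (of_real r * cis t) ^ n = b n * cis (of_nat n * t)" for n t
    by (simp add: b_def power_mult_distrib Complex.DeMoivre)
  have sums: "(\<lambda>n. b n * cis (of_nat n * t)) sums g (of_real r * cis t)" for t
    using taylor_coeff_sums[OF hol, of "of_real r * cis t"] r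
    by (simp add: term_eq norm_mult)
  have "summable (\<lambda>n. norm (taylor_coeff g n * of_real r ^ n))"
  proof (rule powser_insidea)
    show "summable (\<lambda>n. taylor_coeff g n * (of_real ((1 + r) / 2)) ^ n)"
      using taylor_coeff_sums[OF hol, of "of_real ((1 + r) / 2)"] r
      by (intro sums_summable) (auto simp: norm_of_real simp del: of_real_divide of_real_add)
    show "norm (complex_of_real r) < norm (complex_of_real ((1 + r) / 2))"
      using r by (simp add: norm_of_real del: of_real_divide of_real_add)
  qed
  then have sb: "summable (\<lambda>n. norm (b n))" by (simp add: b_def)
  define P where "P N t = (norm (\<Sum>n<N. b n * cis (of_nat n * t)))\<^sup>2" for N t
  have P_int: "(P N has_integral 2 * pi * (\<Sum>n<N. (norm (b n))\<^sup>2)) {0..2 * pi}" for N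
    unfolding P_def[abs_def] by (rule parseval_poly)
  have lim: "(\<lambda>N. P N t) \<longlonglongrightarrow> (norm (g (of_real r * cis t)))\<^sup>2" for t
    unfolding P_def using sums[of t] unfolding sums_def by (intro tendsto_intros)
  have bound: "norm (P N t) \<le> (\<Sum>n. norm (b n))\<^sup>2" for N t
  proof -
    have "norm (\<Sum>n<N. b n * cis (of_nat n * t)) \<le> (\<Sum>n<N. norm (b n))"
      by (rule order_trans[OF norm_sum]) (simp add: norm_mult)
    also have "\<dots> \<le> (\<Sum>n. norm (b n))"
      by (rule sum_le_suminf[OF sb]) auto
    finally show ?thesis
      unfolding P_def by (simp add: power_mono)
  qed
  have dc: "(\<lambda>t. (norm (g (of_real r * cis t)))\<^sup>2) integrable_on {0..2 * pi} \<and>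
     ((\<lambda>N. integral {0..2 * pi} (P N)) \<longlonglongrightarrow> integral {0..2 * pi} (\<lambda>t. (norm (g (of_real r * cis t)))\<^sup>2))"
    using dominated_convergence[of P "{0..2 * pi}" "\<lambda>_. (\<Sum>n. norm (b n))\<^sup>2"
        "\<lambda>t. (norm (g (of_real r * cis t)))\<^sup>2"] P_int bound lim
    by (auto simp: has_integral_integrable)
  then show "(\<lambda>t. (norm (g (of_real r * cis t)))\<^sup>2) integrable_on {0..2 * pi}" ..
  have "(\<lambda>N. integral {0..2 * pi} (P N) / (2 * pi)) \<longlonglongrightarrow>
      integral {0..2 * pi} (\<lambda>t. (norm (g (of_real r * cis t)))\<^sup>2) / (2 * pi)"
    using dc by (intro tendsto_divide tendsto_const) auto
  moreover have "integral {0..2 * pi} (P N) / (2 * pi) =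
      (\<Sum>n<N. (norm (taylor_coeff g n))\<^sup>2 * r ^ (2 * n))" for N
  proof -
    have "(norm (b n))\<^sup>2 = (norm (taylor_coeff g n))\<^sup>2 * r ^ (2 * n)" for n
      using r by (simp add: b_def norm_mult norm_power power_mult_distrib power_mult[symmetric] mult.commute)
    then show ?thesis
      using integral_unique[OF P_int[of N]] by simp
  qed
  ultimately show "(\<lambda>n. (norm (taylor_coeff g n))\<^sup>2 * r ^ (2 * n)) sums
           (integral {0..2 * pi} (\<lambda>t. (norm (g (of_real r * cis t)))\<^sup>2) / (2 * pi))"
    unfolding sums_def by simp
qed

lemma mult_coeff_bound:
  assumes f: "f holomorphic_on ball 0 1" "summable (\<lambda>n. (norm (taylor_coeff f n))\<^sup>2)"
    and \<phi>: "\<phi> holomorphic_on ball 0 1" "\<And>z. z \<in> ball 0 1 \<Longrightarrow> norm (\<phi> z) \<le> K"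
  shows "(\<Sum>n<N. (norm (taylor_coeff (\<lambda>z. \<phi> z * f z) n))\<^sup>2) \<le> K\<^sup>2 * (\<Sum>n. (norm (taylor_coeff f n))\<^sup>2)"
proof -
  let ?c = "taylor_coeff (\<lambda>z. \<phi> z * f z)" and ?d = "taylor_coeff f"
  have hol: "(\<lambda>z. \<phi> z * f z) holomorphic_on ball 0 1"
    using f \<phi> by (intro holomorphic_intros)
  have *: "(\<Sum>n<N. (norm (?c n))\<^sup>2 * r ^ (2 * n)) \<le> K\<^sup>2 * (\<Sum>n. (norm (?d n))\<^sup>2)"
    if r: "0 < r" "r < 1" for r
  proof -
    note pc = parseval[OF hol r] and pd = parseval[OF f(1) r]
    have "(\<Sum>n<N. (norm (?c n))\<^sup>2 * r ^ (2 * n)) \<le>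
        integral {0..2 * pi} (\<lambda>t. (norm (\<phi> (of_real r * cis t) * f (of_real r * cis t)))\<^sup>2) / (2 * pi)"
      using sum_le_suminf[OF sums_summable[OF pc(2)], of "{..<N}"] r sums_unique[OF pc(2)] by simp
    also have "\<dots> \<le> integral {0..2 * pi} (\<lambda>t. K\<^sup>2 * (norm (f (of_real r * cis t)))\<^sup>2) / (2 * pi)"
    proof (intro divide_right_mono integral_le pc(1) integrable_on_mult_right pd(1))
      fix t :: real
      have "norm (\<phi> (of_real r * cis t)) \<le> K"
        using r by (intro \<phi>(2)) (simp add: norm_mult)
      then show "(norm (\<phi> (of_real r * cis t) * f (of_real r * cis t)))\<^sup>2 \<le> K\<^sup>2 * (norm (f (of_real r * cis t)))\<^sup>2"
        by (simp add: norm_mult power_mult_distrib power_mono mult_right_mono)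
    qed auto
    also have "\<dots> = K\<^sup>2 * (integral {0..2 * pi} (\<lambda>t. (norm (f (of_real r * cis t)))\<^sup>2) / (2 * pi))"
      by simp
    also have "\<dots> = K\<^sup>2 * (\<Sum>n. (norm (?d n))\<^sup>2 * r ^ (2 * n))"
      using sums_unique[OF pd(2)] by simp
    also have "\<dots> \<le> K\<^sup>2 * (\<Sum>n. (norm (?d n))\<^sup>2)"
      using r by (intro mult_left_mono suminf_le sums_summable[OF pd(2)] f(2))
        (auto intro!: mult_left_le power_le_one)
    finally show ?thesis .
  qed
  have "((\<lambda>r. \<Sum>n<N. (norm (?c n))\<^sup>2 * r ^ (2 * n)) \<longlongrightarrow> (\<Sum>n<N. (norm (?c n))\<^sup>2 * 1 ^ (2 * n))) (at_left (1::real))"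
    by (intro tendsto_intros)
  moreover have "\<forall>\<^sub>F r in at_left (1::real). (\<Sum>n<N. (norm (?c n))\<^sup>2 * r ^ (2 * n)) \<le> K\<^sup>2 * (\<Sum>n. (norm (?d n))\<^sup>2)"
    using eventually_at_left_real[of 0 "1::real"] by (rule eventually_mono) (auto intro!: *)
  ultimately have "(\<Sum>n<N. (norm (?c n))\<^sup>2 * 1 ^ (2 * n)) \<le> K\<^sup>2 * (\<Sum>n. (norm (?d n))\<^sup>2)"
    by (intro tendsto_upperbound) auto
  then show ?thesis by simp
qed

lemma mult_op_apply:
  assumes "\<phi> \<in> H_infinity"
  shows "h2_fun (blinfun_apply (mult_op \<phi>) f) z = (if z \<in> ball 0 1 then \<phi> z * h2_fun f z else 0)"
proof -
  have hol: "\<phi> holomorphic_on ball 0 1"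
    using assms by (simp add: H_infinity_def)
  obtain K where K: "K > 0" "\<And>z. z \<in> ball 0 1 \<Longrightarrow> norm (\<phi> z) \<le> K"
    using assms unfolding H_infinity_def bounded_pos by auto
  define m where "m f z = (if z \<in> ball 0 1 then \<phi> z * h2_fun f z else 0)" for f z
  have holm: "(\<lambda>z. \<phi> z * h2_fun f z) holomorphic_on ball 0 1" for f
    by (intro holomorphic_intros hol h2_fun_holomorphic)
  have coeff: "taylor_coeff (m f) n = taylor_coeff (\<lambda>z. \<phi> z * h2_fun f z) n" for f n
    by (rule taylor_coeff_cong[OF holm]) (simp add: m_def)
  have bd: "(\<Sum>n<N. (norm (taylor_coeff (m f) n))\<^sup>2) \<le> K\<^sup>2 * (norm f)\<^sup>2" for f N
    unfolding norm_h2_sq coeff h2_coeff_def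
    using mult_coeff_bound[OF h2_fun_holomorphic _ hol K(2)] summable_h2_coeff[of f]
    by (simp add: h2_coeff_def)
  have summ: "summable (\<lambda>n. (norm (taylor_coeff (m f) n))\<^sup>2)" for f
    by (rule summableI_nonneg_bounded[OF _ bd]) simp
  have "m f holomorphic_on ball 0 1" for f
    using holm[of f] by (rule holomorphic_transform) (simp add: m_def)
  with summ have rep: "h2_fun (Abs_h2 (m f)) = m f" for f
    by (intro Abs_h2_inverse) (auto simp: m_def)
  have "bounded_linear (\<lambda>f. Abs_h2 (m f))"
  proof (rule bounded_linear_intro)
    show "Abs_h2 (m (x + y)) = Abs_h2 (m x) + Abs_h2 (m y)" for x y
      by (rule h2_eqI) (simp add: rep plus_h2.rep_eq m_def distrib_left)
    show "Abs_h2 (m (c *\<^sub>R x)) = c *\<^sub>R Abs_h2 (m x)" for c x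
      by (rule h2_eqI) (simp add: rep scaleR_h2_def h2_scaleC.rep_eq m_def)
    show "norm (Abs_h2 (m f)) \<le> norm f * K" for f
    proof -
      have "(norm (Abs_h2 (m f)))\<^sup>2 \<le> K\<^sup>2 * (norm f)\<^sup>2"
        unfolding norm_h2_sq[of "Abs_h2 (m f)"] h2_coeff_def rep
        using bd by (intro suminf_le_const summ)
      also have "\<dots> = (norm f * K)\<^sup>2" by (simp add: power_mult_distrib mult.commute)
      finally show ?thesis
        using K by (simp add: power2_le_iff_abs_le)
    qed
  qed
  from bounded_linear_Blinfun_apply[OF this] show ?thesis
    unfolding mult_op_def m_def[symmetric] by (simp add: rep)
qed

lemma mult_op_in_L_H2:
  assumes "\<phi> \<in> H_infinity"
  shows "mult_op \<phi> \<in> L_H2"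
  unfolding L_H2_def
  by (auto intro!: h2_eqI simp: mult_op_apply[OF assms] h2_scaleC.rep_eq)

definition shift :: "h2 \<Rightarrow>\<^sub>L h2" where
  "shift = mult_op (\<lambda>z. z)"

lemma shift_apply: "h2_fun (blinfun_apply shift f) z = z * h2_fun f z"
proof -
  have "(\<lambda>z. z) \<in> H_infinity" by (auto simp: H_infinity_def)
  from mult_op_apply[OF this] show ?thesis
    by (simp add: shift_def h2_fun_outside)
qed


section \<open>Inner functions\<close>

definition stolz_region :: "real \<Rightarrow> complex \<Rightarrow> complex set" where
  "stolz_region \<alpha> \<zeta> = {z \<in> ball 0 1. norm (\<zeta> - z) < \<alpha> * (1 - norm z)}"

text \<open>Apertures \<open>\<alpha> \<le> 1\<close> are excluded because the region is then empty.\<close>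

definition has_nontangential_limit :: "(complex \<Rightarrow> complex) \<Rightarrow> complex \<Rightarrow> complex \<Rightarrow> bool" where
  "has_nontangential_limit f w \<zeta> \<longleftrightarrow>
     (\<forall>\<alpha>>1. (f \<longlongrightarrow> w) (at \<zeta> within stolz_region \<alpha> \<zeta>))"

text \<open>The null set of exceptional boundary points \<open>cis t\<close> is measured over all real \<open>t\<close>. By
  periodicity this agrees with arc length measure on the circle. The existence of the boundary
  value at almost every point is part of the definition.\<close>

definition inner_function :: "(complex \<Rightarrow> complex) \<Rightarrow> bool" where
  "inner_function \<theta> \<longleftrightarrow> \<theta> \<in> H_infinity \<and>
     (AE t in lborel. \<exists>w. has_nontangential_limit \<theta> w (cis t) \<and> norm w = 1)"


section \<open>Invariant subspaces\<close>

definition closed_shift_invariant :: "(h2 \<Rightarrow>\<^sub>L h2) set \<Rightarrow> bool" where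
  "closed_shift_invariant M \<longleftrightarrow>
     M \<subseteq> L_H2 \<and> op.subspace M \<and> closed M \<and> (\<forall>T\<in>M. shift o\<^sub>L T \<in> M)"

definition generates_H2 :: "h2 set \<Rightarrow> bool" where
  "generates_H2 E \<longleftrightarrow> closure (h2.span E) = UNIV"

end

theory Submission
  imports Defs
begin

text \<open>
  Let \<open>N\<close> be the closed linear span of the ranges of the operators in \<open>M\<close>. It is a nonzero
  closed shift-invariant subspace of \<open>H\<^sup>2\<close>, so Beurling's theorem gives \<open>N = \<theta> H\<^sup>2\<close> with \<open>\<theta>\<close> inner.
  Multiplication by \<open>\<theta>\<close> is an isometry onto \<open>N\<close>. Hence every \<open>T\<close> in \<open>M\<close> factors through it
  (\<open>factor_through_isometry\<close>), and the factors form the family \<open>M'\<close> of all \<open>T'\<close> for which the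
  product lies in \<open>M\<close>. Its ranges generate \<open>H\<^sup>2\<close> because an isometry carries the closed span of
  the ranges of \<open>M'\<close> onto a closed subspace that contains \<open>N\<close>. Conversely, composition with an
  isometry preserves the operator norm, so it maps closed subspaces of operators to closed
  subspaces (\<open>closed_shift_invariant_image\<close>).

  Beurling's theorem is proved without boundary values
  (\<open>invariant_subspace_eq_range_mult_op\<close>). A nonzero invariant subspace \<open>N\<close> contains a unit vector
  \<open>t\<close> orthogonal to the shift of \<open>N\<close>. The vectors \<open>z\<^sup>n t\<close> are then orthonormal, so multiplying
  polynomials by \<open>t\<close> preserves norms. Testing against the truncated reproducing kernels gives
  \<open>\<bar>t\<bar> \<le> 1\<close>, and multiplication by \<open>t\<close> extends to an isometry of \<open>H\<^sup>2\<close> into \<open>N\<close>. If its range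
  missed part of \<open>N\<close>, the orthogonal complement of the range in \<open>N\<close> would again be invariant
  and contain such a unit vector \<open>s\<close>; but the product \<open>s t = t s\<close> lies both in the range and in
  the complement, and has norm 1.

  It remains to compare isometric multipliers with inner functions, which are defined by their
  boundary values. For a bounded \<open>g\<close>, letting the radius tend to 1 in Parseval's identity expresses the
  \<open>H\<^sup>2\<close> norm through the radial limits of \<open>\<bar>g\<bar>\<^sup>2\<close> (\<open>boundary_parseval\<close>). This shows
  that an inner function multiplies isometrically, and that a bounded multiplier that is isometric
  has limits of modulus 1 wherever limits exist, up to a null set. That nontangential limits exist almost
  everywhere is Fatou's theorem (\<open>bounded_holomorphic_nontangential_limits\<close>). Here is the
  idea of its proof. A primitive \<open>F\<close> of the bounded function \<open>f\<close> is Lipschitz and extends to the closed disc.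
  Subtracting from \<open>F\<close> a primitive of a Taylor polynomial of \<open>f\<close> leaves a boundary function
  whose variation is controlled by the \<open>H\<^sup>2\<close> norm of the Taylor tail, so it is arbitrarily
  small. Vitali's covering theorem turns this into differentiability of \<open>t \<mapsto> F (cis t)\<close> at almost every \<open>t\<close>
  (\<open>differentiable_ae_of_variation_limit\<close>). At such a point the difference quotient of \<open>F\<close> has a limit
  along the circle. As the quotient is bounded, averaging it over Moebius images of the circle carries the
  limit into the disc (\<open>limit_in_disc_of_limit_on_circle\<close>), and Cauchy's estimate on discs of
  radius comparable to the distance to the boundary yields the nontangential limit of \<open>f = F'\<close>.
\<close>

section \<open>Projections in Hilbert space\<close>

lemma parallelogram:
  fixes x a b :: "'a::real_inner"
  shows "(norm ((x - a) + (x - b)))\<^sup>2 = 2 * (norm (x - a))\<^sup>2 + 2 * (norm (x - b))\<^sup>2 - (norm (a - b))\<^sup>2"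
  using dot_norm[of "x - a" "x - b"] dot_norm_neg[of "x - a" "x - b"]
  by (simp add: field_simps norm_minus_commute)

text \<open>A minimising sequence for the distance from \<open>x\<close> to \<open>V\<close> converges, and its limit is the foot of
  the perpendicular.\<close>

lemma orthogonal_projection_exists:
  fixes V :: "'a::{real_inner, complete_space} set"
  assumes cl: "closed V" and sub: "subspace V"
  obtains v where "v \<in> V" "\<And>u. u \<in> V \<Longrightarrow> inner (x - v) u = 0"
proof -
  have ne: "V \<noteq> {}" using sub subspace_0 by blast
  define d where "d = infdist x V"
  have d_le: "d \<le> norm (x - v)" if "v \<in> V" for v
    using infdist_le[OF that, of x] by (simp add: d_def dist_norm)
  have d0: "0 \<le> d" by (simp add: d_def infdist_nonneg)
  have "\<exists>v\<in>V. norm (x - v) < d + 1 / Suc n" for n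
    using cInf_lessD[of "(dist x) ` V" "d + 1 / Suc n"] ne
    by (auto simp: d_def infdist_def dist_norm)
  then obtain v where v: "\<And>n. v n \<in> V" "\<And>n. norm (x - v n) < d + 1 / Suc n"
    by metis
  define a where "a n = (norm (x - v n))\<^sup>2 - d\<^sup>2" for n
  have lim: "(\<lambda>n. norm (x - v n)) \<longlonglongrightarrow> d"
  proof (rule tendsto_sandwich[OF _ _ tendsto_const])
    show "(\<lambda>n. d + 1 / Suc n) \<longlonglongrightarrow> d"
      using tendsto_add[OF tendsto_const LIMSEQ_inverse_real_of_nat, of d]
      by (simp add: inverse_eq_divide)
  qed (use d_le v(1) less_imp_le[OF v(2)] in \<open>auto intro!: always_eventually\<close>)
  have a: "a \<longlonglongrightarrow> 0"
    unfolding a_def using tendsto_diff[OF tendsto_power[OF lim, of 2] tendsto_const[of "d\<^sup>2"]] by simp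
  \<comment> \<open>The parallelogram law turns almost minimal distance into the Cauchy property.\<close>
  have par: "(norm (v m - v n))\<^sup>2 \<le> 2 * a m + 2 * a n" for m n
  proof -
    have "(1/2) *\<^sub>R (v m + v n) \<in> V"
      using sub v(1) by (intro subspace_scale subspace_add)
    from power_mono[OF d_le[OF this] d0, of 2]
    have "4 * d\<^sup>2 \<le> (2 * norm (x - (1/2) *\<^sub>R (v m + v n)))\<^sup>2"
      by (simp add: power_mult_distrib)
    also have "2 * norm (x - (1/2) *\<^sub>R (v m + v n)) = norm (2 *\<^sub>R (x - (1/2) *\<^sub>R (v m + v n)))"
      by simp
    also have "2 *\<^sub>R (x - (1/2) *\<^sub>R (v m + v n)) = (x - v m) + (x - v n)"
      by (simp add: algebra_simps scaleR_2)
    also have "(norm \<dots>)\<^sup>2 = 2 * (norm (x - v m))\<^sup>2 + 2 * (norm (x - v n))\<^sup>2 - (norm (v m - v n))\<^sup>2"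
      by (rule parallelogram)
    finally show ?thesis by (simp add: a_def)
  qed
  have "Cauchy v"
  proof (rule metric_CauchyI)
    fix e :: real assume e: "0 < e"
    then have "\<forall>\<^sub>F n in sequentially. a n < e\<^sup>2 / 4"
      using a by (intro order_tendstoD(2)[OF a]) auto
    then obtain N where N: "\<And>n. n \<ge> N \<Longrightarrow> a n < e\<^sup>2 / 4"
      by (auto simp: eventually_sequentially)
    have "dist (v m) (v n) < e" if "m \<ge> N" "n \<ge> N" for m n
    proof -
      have "(norm (v m - v n))\<^sup>2 < e\<^sup>2"
        using par[of m n] N[OF that(1)] N[OF that(2)] by linarith
      then show ?thesis using e by (simp add: dist_norm power2_less_imp_less)
    qed
    then show "\<exists>M. \<forall>m\<ge>M. \<forall>n\<ge>M. dist (v m) (v n) < e" by blast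
  qed
  then obtain w where w: "v \<longlonglongrightarrow> w"
    using Cauchy_convergent convergent_def by blast
  have wV: "w \<in> V"
    using closed_sequentially[OF cl] v(1) w by blast
  have "(\<lambda>n. norm (x - v n)) \<longlonglongrightarrow> norm (x - w)"
    by (intro tendsto_intros w)
  then have wd: "norm (x - w) = d" using lim LIMSEQ_unique by blast
  have "inner (x - w) u = 0" if u: "u \<in> V" for u
  proof (cases "u = 0")
    case False
    \<comment> \<open>The multiple of \<open>u\<close> for which the distance from \<open>x\<close> to \<open>w + t u\<close> is smallest.\<close>
    define t where "t = inner (x - w) u / inner u u"
    have "w + t *\<^sub>R u \<in> V" using wV u sub by (intro subspace_add subspace_scale)
    from power_mono[OF d_le[OF this] d0, of 2]
    have "inner (x - w) (x - w) \<le> inner ((x - w) - t *\<^sub>R u) ((x - w) - t *\<^sub>R u)"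
      using wd by (simp add: power2_norm_eq_inner[symmetric] algebra_simps)
    also have "\<dots> = inner (x - w) (x - w) - 2 * t * inner (x - w) u + t * t * inner u u"
      by (simp only: inner_diff_left inner_diff_right inner_scaleR_left inner_scaleR_right
          inner_commute[of u "x - w"] inner_commute[of u x] inner_commute[of u w])
         (simp add: algebra_simps)
    also have "\<dots> = inner (x - w) (x - w) - (inner (x - w) u)\<^sup>2 / inner u u"
      using False by (simp add: t_def field_simps power2_eq_square)
    finally have "(inner (x - w) u)\<^sup>2 / inner u u \<le> 0" by simp
    then show ?thesis using False by (simp add: divide_le_eq)
  qed simp
  then show ?thesis by (rule that[OF wV])
qed


section \<open>Coordinates in the Hardy space\<close>

lemma h2_coeff_zero [simp]: "h2_coeff 0 n = 0"
  using h2_eq_0_iff by blast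

lemma h2_coeff_diff: "h2_coeff (f - g) n = h2_coeff f n - h2_coeff g n"
  unfolding minus_h2_def uminus_h2_def h2_coeff_add h2_coeff_scaleC by simp

lemma h2_fun_sums: "z \<in> ball 0 1 \<Longrightarrow> (\<lambda>n. h2_coeff f n * z ^ n) sums h2_fun f z"
  unfolding h2_coeff_def by (rule taylor_coeff_sums[OF h2_fun_holomorphic])

lemma taylor_coeff_unique:
  assumes "\<And>z. z \<in> ball 0 1 \<Longrightarrow> (\<lambda>n. a n * z ^ n) sums f z"
  shows "taylor_coeff f n = a n"
proof -
  define F where "F = Abs_fps a"
  have "conv_radius a \<ge> 1"
  proof (rule conv_radius_geI_ex')
    fix r :: real assume "0 < r" "ereal r < 1"
    then show "summable (\<lambda>n. a n * of_real r ^ n)"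
      using assms[of "of_real r"] by (auto simp: sums_iff one_ereal_def)
  qed
  then have "fps_conv_radius F > 0"
    by (auto simp: F_def fps_conv_radius_def intro: less_le_trans[of 0 "1::ereal"])
  then have exp: "eval_fps F has_fps_expansion F"
    by (rule eval_fps_has_fps_expansion)
  have hol: "f holomorphic_on ball 0 1"
    by (rule power_series_holomorphic[of 0 1 a]) (use assms in simp)
  have "taylor_coeff f n = taylor_coeff (eval_fps F) n"
    unfolding taylor_coeff_def
  proof (intro arg_cong2[where f="(/)"] refl higher_deriv_transform_within_open[of _ "ball 0 1"])
    show eq: "f z = eval_fps F z" if "z \<in> ball 0 1" for z
      using assms[OF that] by (simp add: F_def eval_fps_def sums_iff)
    show "eval_fps F holomorphic_on ball 0 1"
      by (rule holomorphic_transform[OF hol]) (use eq in auto)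
  qed (auto simp: hol)
  also have "\<dots> = a n"
    using fps_nth_fps_expansion[OF exp, of n] by (simp add: taylor_coeff_def F_def)
  finally show ?thesis .
qed

definition h2_of_coeff :: "(nat \<Rightarrow> complex) \<Rightarrow> h2" where
  "h2_of_coeff a = Abs_h2 (\<lambda>z. if z \<in> ball 0 1 then \<Sum>n. a n * z ^ n else 0)"

lemma summable_norm_power_square:
  fixes z :: complex
  assumes "norm z < 1"
  shows "summable (\<lambda>n. (norm (z ^ n))\<^sup>2)"
proof -
  have "(norm (z ^ n))\<^sup>2 = ((norm z)\<^sup>2) ^ n" for n
    by (simp add: norm_power mult.commute flip: power_mult)
  then show ?thesis
    using assms by (simp add: summable_geometric abs_square_less_1)
qed

lemma square_summable_power_series_summable:
  fixes a :: "nat \<Rightarrow> complex"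
  assumes "summable (\<lambda>n. (norm (a n))\<^sup>2)" "norm z < 1"
  shows "summable (\<lambda>n. a n * z ^ n)"
proof -
  have "summable (\<lambda>n. (norm (cnj z ^ n))\<^sup>2)"
    using assms(2) by (intro summable_norm_power_square) simp
  from summable_mult_cnj[OF assms(1) this] show ?thesis by simp
qed

lemma
  assumes "summable (\<lambda>n. (norm (a n))\<^sup>2)"
  shows h2_coeff_of_coeff: "h2_coeff (h2_of_coeff a) n = a n"
    and h2_fun_of_coeff: "z \<in> ball 0 1 \<Longrightarrow> (\<lambda>n. a n * z ^ n) sums h2_fun (h2_of_coeff a) z"
proof -
  define f where "f = (\<lambda>z::complex. if z \<in> ball 0 1 then \<Sum>n. a n * z ^ n else 0)"
  have s: "(\<lambda>n. a n * z ^ n) sums f z" if "z \<in> ball 0 1" for z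
    using square_summable_power_series_summable[OF assms, of z] that
    by (simp add: f_def summable_sums)
  have c: "taylor_coeff f n = a n" for n
    by (rule taylor_coeff_unique[OF s])
  have "f holomorphic_on ball 0 1"
    by (rule power_series_holomorphic[of 0 1 a]) (use s in simp)
  then have rep: "h2_fun (h2_of_coeff a) = f"
    unfolding h2_of_coeff_def f_def[symmetric]
  proof (intro Abs_h2_inverse CollectI conjI)
    show "summable (\<lambda>n. (norm (taylor_coeff f n))\<^sup>2)" using assms by (simp only: c)
  qed (auto simp: f_def)
  show "h2_coeff (h2_of_coeff a) n = a n"
    by (simp add: h2_coeff_def rep c)
  show "z \<in> ball 0 1 \<Longrightarrow> (\<lambda>n. a n * z ^ n) sums h2_fun (h2_of_coeff a) z"
    using s rep by simp
qed

lemma norm_h2_coeff_le: "norm (h2_coeff f n) \<le> norm f"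
proof -
  have "(norm (h2_coeff f n))\<^sup>2 \<le> (norm f)\<^sup>2"
    unfolding norm_h2_sq using sum_le_suminf[OF summable_h2_coeff, of "{n}" f] by simp
  then show ?thesis by (simp add: power2_le_iff_abs_le)
qed

lemma bounded_linear_h2_coeff: "bounded_linear (\<lambda>f. h2_coeff f n)"
  by (rule bounded_linear_intro[of _ 1])
    (auto simp: h2_coeff_add scaleR_h2_def h2_coeff_scaleC scaleR_conv_of_real norm_h2_coeff_le)

text \<open>Coefficients of a Cauchy sequence converge one by one. The bounds for finite sums of squared
  differences are uniform in the number of terms, so they survive the limit and give convergence in
  norm.\<close>

instance h2 :: complete_space
proof
  fix X :: "nat \<Rightarrow> h2" assume X: "Cauchy X"
  have "convergent (\<lambda>k. h2_coeff (X k) n)" for n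
    using bounded_linear.Cauchy[OF bounded_linear_h2_coeff X] by (rule Cauchy_convergent)
  then obtain a where a: "\<And>n. (\<lambda>k. h2_coeff (X k) n) \<longlonglongrightarrow> a n"
    unfolding convergent_def by metis
  have bd: "\<exists>K. \<forall>j\<ge>K. \<forall>N. (\<Sum>n<N. (norm (h2_coeff (X j) n - a n))\<^sup>2) \<le> e\<^sup>2" if e: "e > 0" for e
  proof -
    obtain K where K: "\<And>j k. j \<ge> K \<Longrightarrow> k \<ge> K \<Longrightarrow> dist (X j) (X k) < e"
      using metric_CauchyD[OF X e] by blast
    have "(\<Sum>n<N. (norm (h2_coeff (X j) n - a n))\<^sup>2) \<le> e\<^sup>2" if j: "j \<ge> K" for j N
    proof (rule tendsto_upperbound)
      show "(\<lambda>k. \<Sum>n<N. (norm (h2_coeff (X j) n - h2_coeff (X k) n))\<^sup>2)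
          \<longlonglongrightarrow> (\<Sum>n<N. (norm (h2_coeff (X j) n - a n))\<^sup>2)"
        by (intro tendsto_intros a)
      have "(\<Sum>n<N. (norm (h2_coeff (X j) n - h2_coeff (X k) n))\<^sup>2) \<le> e\<^sup>2" if "k \<ge> K" for k
      proof -
        have "(\<Sum>n<N. (norm (h2_coeff (X j - X k) n))\<^sup>2) \<le> (norm (X j - X k))\<^sup>2"
          unfolding norm_h2_sq by (rule sum_le_suminf[OF summable_h2_coeff]) auto
        also have "\<dots> \<le> e\<^sup>2"
          using K[OF j that] by (simp add: dist_norm power_mono)
        finally show ?thesis by (simp add: h2_coeff_diff)
      qed
      then show "\<forall>\<^sub>F k in sequentially. (\<Sum>n<N. (norm (h2_coeff (X j) n - h2_coeff (X k) n))\<^sup>2) \<le> e\<^sup>2"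
        by (auto simp: eventually_sequentially)
    qed simp
    then show ?thesis by blast
  qed
  obtain K where K: "\<And>N. (\<Sum>n<N. (norm (h2_coeff (X K) n - a n))\<^sup>2) \<le> 1"
    using bd[of 1] by auto
  have "summable (\<lambda>n. (norm (h2_coeff (X K) n - a n))\<^sup>2)"
    by (rule summableI_nonneg_bounded[OF _ K]) simp
  from summable_norm_add_sq[OF summable_h2_coeff[of "X K"], of "\<lambda>n. a n - h2_coeff (X K) n"] this
  have "summable (\<lambda>n. (norm (a n))\<^sup>2)"
    by (simp add: norm_minus_commute)
  note co = h2_coeff_of_coeff[OF this]
  have "X \<longlonglongrightarrow> h2_of_coeff a"
  proof (rule metric_LIMSEQ_I)
    fix r :: real assume r: "r > 0"
    obtain L where L: "\<And>j N. j \<ge> L \<Longrightarrow> (\<Sum>n<N. (norm (h2_coeff (X j) n - a n))\<^sup>2) \<le> (r / 2)\<^sup>2"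
      using bd[of "r / 2"] r by auto
    have "dist (X j) (h2_of_coeff a) < r" if "j \<ge> L" for j
    proof -
      have "(norm (X j - h2_of_coeff a))\<^sup>2 \<le> (r / 2)\<^sup>2"
        unfolding norm_h2_sq
        by (rule suminf_le_const[OF summable_h2_coeff]) (use L[OF that] in \<open>simp add: h2_coeff_diff co\<close>)
      then have "norm (X j - h2_of_coeff a) \<le> r / 2"
        using r by (simp add: power2_le_iff_abs_le)
      with r show ?thesis by (simp add: dist_norm)
    qed
    then show "\<exists>no. \<forall>n\<ge>no. dist (X n) (h2_of_coeff a) < r" by blast
  qed
  then show "convergent X" by (auto simp: convergent_def)
qed

instance h2 :: banach ..

definition h2_trunc :: "nat \<Rightarrow> h2 \<Rightarrow> h2" where
  "h2_trunc N f = h2_of_coeff (\<lambda>n. if n < N then h2_coeff f n else 0)"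

lemma summable_trunc:
  fixes a :: "nat \<Rightarrow> complex"
  shows "summable (\<lambda>n. (norm (if n < N then a n else 0))\<^sup>2)"
  by (rule summable_finite[of "{..<N}"]) auto

lemma h2_coeff_trunc: "h2_coeff (h2_trunc N f) n = (if n < N then h2_coeff f n else 0)"
  unfolding h2_trunc_def by (rule h2_coeff_of_coeff[OF summable_trunc])

lemma h2_fun_trunc:
  assumes "z \<in> ball 0 1"
  shows "h2_fun (h2_trunc N f) z = (\<Sum>n<N. h2_coeff f n * z ^ n)"
proof -
  have "(\<lambda>n. (if n < N then h2_coeff f n else 0) * z ^ n) sums h2_fun (h2_trunc N f) z"
    using h2_fun_sums[OF assms, of "h2_trunc N f"] by (simp add: h2_coeff_trunc)
  moreover have "(\<lambda>n. (if n < N then h2_coeff f n else 0) * z ^ n) sums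
      (\<Sum>n<N. (if n < N then h2_coeff f n else 0) * z ^ n)"
    by (rule sums_finite) auto
  ultimately show ?thesis using sums_unique2 by fastforce
qed

lemma norm_h2_trunc_sq: "(norm (h2_trunc N f))\<^sup>2 = (\<Sum>n<N. (norm (h2_coeff f n))\<^sup>2)"
  unfolding norm_h2_sq h2_coeff_trunc
  by (subst suminf_finite[of "{..<N}"]) auto

lemma h2_trunc_tendsto: "(\<lambda>N. h2_trunc N f) \<longlonglongrightarrow> f"
proof -
  have eq: "(norm (f - h2_trunc N f))\<^sup>2 = (norm f)\<^sup>2 - (\<Sum>n<N. (norm (h2_coeff f n))\<^sup>2)" for N
  proof -
    have "(norm f)\<^sup>2 = (\<Sum>n. (norm (h2_coeff (f - h2_trunc N f) n))\<^sup>2 + (norm (h2_coeff (h2_trunc N f) n))\<^sup>2)"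
      unfolding norm_h2_sq by (intro suminf_cong) (auto simp: h2_coeff_diff h2_coeff_trunc)
    also have "\<dots> = (norm (f - h2_trunc N f))\<^sup>2 + (norm (h2_trunc N f))\<^sup>2"
      unfolding norm_h2_sq by (rule suminf_add[symmetric]; rule summable_h2_coeff)
    finally show ?thesis by (simp add: norm_h2_trunc_sq)
  qed
  have "(\<lambda>N. (norm f)\<^sup>2 - (\<Sum>n<N. (norm (h2_coeff f n))\<^sup>2)) \<longlonglongrightarrow> (norm f)\<^sup>2 - (norm f)\<^sup>2"
    unfolding norm_h2_sq by (intro tendsto_intros summable_LIMSEQ summable_h2_coeff)
  then have "(\<lambda>N. (norm (f - h2_trunc N f))\<^sup>2) \<longlonglongrightarrow> 0" by (simp add: eq)
  then have "(\<lambda>N. norm (f - h2_trunc N f)) \<longlonglongrightarrow> 0"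
    using tendsto_real_sqrt by fastforce
  then show ?thesis
    by (subst tendsto_dist_iff) (simp add: dist_norm norm_minus_commute)
qed

lemma inner_h2_eq: "inner f g = (\<Sum>n. Re (h2_coeff f n * cnj (h2_coeff g n)))"
  unfolding inner_h2_def h2_cinner_def by (rule Re_suminf[OF summable_h2_cinner])

text \<open>The real inner product carries the Hermitian structure through this adjoint rule. It lets
  orthogonality to a complex subspace be handled with real orthogonality alone.\<close>

lemma inner_h2_scaleC: "inner (h2_scaleC c f) g = inner f (h2_scaleC (cnj c) g)"
  unfolding inner_h2_eq h2_coeff_scaleC by (simp add: mult_ac)

lemma h2_subspace_imp_subspace: "h2.subspace V \<Longrightarrow> subspace V"
  unfolding subspace_def h2.subspace_def by (auto simp: scaleR_h2_def)


section \<open>Evaluation and multiplication\<close>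

text \<open>The Szego kernel, which reproduces point evaluation (\<open>inner_h2_kernel\<close>).\<close>

definition h2_kernel :: "complex \<Rightarrow> h2" where
  "h2_kernel z = h2_of_coeff (\<lambda>n. cnj z ^ n)"

lemma h2_coeff_kernel:
  assumes "z \<in> ball 0 1"
  shows "h2_coeff (h2_kernel z) n = cnj z ^ n"
  unfolding h2_kernel_def
proof (rule h2_coeff_of_coeff)
  show "summable (\<lambda>n. (norm (cnj z ^ n))\<^sup>2)"
    using assms by (intro summable_norm_power_square) simp
qed

lemma inner_h2_kernel:
  assumes "z \<in> ball 0 1"
  shows "inner f (h2_kernel z) = Re (h2_fun f z)"
  using h2_fun_sums[OF assms, of f]
  by (simp add: inner_h2_def h2_cinner_def h2_coeff_kernel[OF assms] sums_iff)

lemma norm_h2_fun_le: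
  assumes "z \<in> ball 0 1"
  shows "norm (h2_fun f z) \<le> norm f * norm (h2_kernel z)"
proof -
  \<comment> \<open>A unimodular factor makes the value real and nonnegative, so that the real inner product sees
    its full modulus.\<close>
  obtain c where c: "norm c = 1" "c * h2_fun f z = of_real (norm (h2_fun f z))"
  proof (cases "h2_fun f z = 0")
    case False
    let ?v = "h2_fun f z"
    have "cnj ?v * ?v = of_real (norm ?v) * of_real (norm ?v)"
      using complex_norm_square[of ?v] by (simp add: power2_eq_square mult.commute)
    with False show ?thesis
      by (intro that[of "cnj ?v / of_real (norm ?v)"]) (simp_all add: norm_divide)
  qed (use that[of 1] in simp)
  have "norm (h2_fun f z) = inner (h2_scaleC c f) (h2_kernel z)"
    using c(2) by (simp add: inner_h2_kernel[OF assms] h2_scaleC.rep_eq)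
  also have "\<dots> \<le> norm (h2_scaleC c f) * norm (h2_kernel z)"
    by (rule norm_cauchy_schwarz)
  finally show ?thesis by (simp add: norm_h2_scaleC c)
qed

lemma h2_coeff_shift: "h2_coeff (shift f) n = (case n of 0 \<Rightarrow> 0 | Suc m \<Rightarrow> h2_coeff f m)"
  unfolding h2_coeff_def[of "shift f"]
proof (rule taylor_coeff_unique)
  fix z :: complex assume z: "z \<in> ball 0 1"
  have "(\<lambda>n. (case Suc n of 0 \<Rightarrow> 0 | Suc m \<Rightarrow> h2_coeff f m) * z ^ Suc n) sums (z * h2_fun f z)"
    using sums_mult[OF h2_fun_sums[OF z, of f], of z] by (simp add: mult_ac)
  from sums_Suc[OF this]
  show "(\<lambda>n. (case n of 0 \<Rightarrow> 0 | Suc m \<Rightarrow> h2_coeff f m) * z ^ n) sums h2_fun (shift f) z"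
    by (simp add: shift_apply)
qed

lemma inner_shift: "inner (shift f) (shift g) = inner f g"
proof -
  have "summable (\<lambda>n. Re (h2_coeff (shift f) n * cnj (h2_coeff (shift g) n)))"
    by (rule summable_Re[OF summable_h2_cinner])
  from suminf_split_head[OF this] show ?thesis
    unfolding inner_h2_eq by (simp add: h2_coeff_shift)
qed

lemma shift_scaleC: "shift (h2_scaleC c f) = h2_scaleC c (shift f)"
  by (rule h2_eqI) (simp add: shift_apply h2_scaleC.rep_eq)

lemma h2_fun_shift_power: "h2_fun ((blinfun_apply shift ^^ n) f) z = z ^ n * h2_fun f z"
  by (induction n) (auto simp: shift_apply)

lemma inner_shift_power: "inner ((blinfun_apply shift ^^ n) f) ((blinfun_apply shift ^^ n) g) = inner f g"
  by (induction n) (auto simp: inner_shift)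

lemma shift_power_scaleC: "(blinfun_apply shift ^^ n) (h2_scaleC c f) = h2_scaleC c ((blinfun_apply shift ^^ n) f)"
  by (induction n) (auto simp: shift_scaleC)


section \<open>Wandering vectors\<close>

definition invariant_subspace :: "h2 set \<Rightarrow> bool" where
  "invariant_subspace N \<longleftrightarrow> h2.subspace N \<and> closed N \<and> (\<forall>f\<in>N. shift f \<in> N)"

lemma invariant_subspace_shift_power:
  assumes "invariant_subspace N" "f \<in> N"
  shows "(blinfun_apply shift ^^ n) f \<in> N"
  using assms by (induction n) (auto simp: invariant_subspace_def)

text \<open>Let \<open>k\<close> be the least order of vanishing at 0 among the elements of \<open>N\<close>, attained by \<open>g\<close>.
  Every shifted element of \<open>N\<close> has vanishing \<open>k\<close>-th coefficient. The component of \<open>g\<close> orthogonal to all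
  such elements of \<open>N\<close> is therefore orthogonal to the shift of \<open>N\<close>, and it is nonzero because its own
  \<open>k\<close>-th coefficient is.\<close>

lemma wandering_vector_exists:
  assumes N: "invariant_subspace N" and ne: "N \<noteq> {0}"
  obtains t where "t \<in> N" "norm t = 1" "\<And>h. h \<in> N \<Longrightarrow> inner t (shift h) = 0"
proof -
  have sub: "h2.subspace N" and cl: "closed N" and inv: "\<And>f. f \<in> N \<Longrightarrow> shift f \<in> N"
    using N by (auto simp: invariant_subspace_def)
  define P where "P k \<longleftrightarrow> (\<exists>g\<in>N. h2_coeff g k \<noteq> 0)" for k
  obtain g0 where "g0 \<in> N" "g0 \<noteq> 0" using ne h2.subspace_0[OF sub] by blast
  then have "\<exists>k. P k" using h2_eq_0_iff P_def by blast
  define k where "k = (LEAST k. P k)"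
  have "P k" using \<open>\<exists>k. P k\<close> unfolding k_def by (rule LeastI_ex)
  then obtain g where g: "g \<in> N" "h2_coeff g k \<noteq> 0" unfolding P_def by blast
  have less: "h2_coeff h j = 0" if "j < k" "h \<in> N" for h j
    using not_less_Least[of j P] that by (auto simp: k_def P_def)
  define V where "V = {h \<in> N. h2_coeff h k = 0}"
  have "closed V"
    unfolding V_def Collect_conj_eq Collect_mem_eq
    by (intro closed_Int cl closed_Collect_eq continuous_intros
        bounded_linear.continuous_on[OF bounded_linear_h2_coeff])
  moreover have "subspace V"
    using sub by (intro h2_subspace_imp_subspace)
      (auto simp: V_def h2.subspace_def h2_coeff_add h2_coeff_scaleC)
  ultimately obtain v where v: "v \<in> V" "\<And>u. u \<in> V \<Longrightarrow> inner (g - v) u = 0"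
    using orthogonal_projection_exists[of V g] by blast
  define w where "w = g - v"
  have w: "w \<in> N" "w \<noteq> 0"
    using g v(1) h2.subspace_diff[OF sub] by (auto simp: w_def V_def)
  have "shift h \<in> V" if "h \<in> N" for h
    using that less inv by (auto simp: V_def h2_coeff_shift split: nat.split)
  then have orth: "inner w (shift h) = 0" if "h \<in> N" for h
    using that v(2) by (simp add: w_def)
  show ?thesis
  proof (rule that[of "inverse (norm w) *\<^sub>R w"])
    show "inverse (norm w) *\<^sub>R w \<in> N"
      using w(1) sub by (intro subspace_scale h2_subspace_imp_subspace)
  qed (use w orth in auto)
qed

text \<open>Cancelling the common power of the isometric shift leaves \<open>t\<close> against a shifted element of
  \<open>N\<close>.\<close>

lemma wandering_orthogonal:
  assumes N: "invariant_subspace N" and t: "t \<in> N" and orth: "\<And>h. h \<in> N \<Longrightarrow> inner t (shift h) = 0"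
    and nm: "n < m"
  shows "inner (h2_scaleC c ((blinfun_apply shift ^^ n) t)) (h2_scaleC d ((blinfun_apply shift ^^ m) t)) = 0"
proof -
  have sub: "h2.subspace N" using N by (simp add: invariant_subspace_def)
  define h where "h = h2_scaleC (cnj c * d) ((blinfun_apply shift ^^ (m - Suc n)) t)"
  have "h \<in> N"
    unfolding h_def using N t sub by (intro h2.subspace_scale invariant_subspace_shift_power)
  have "(blinfun_apply shift ^^ m) t = (blinfun_apply shift ^^ n) (shift ((blinfun_apply shift ^^ (m - Suc n)) t))"
  proof -
    have "m = n + Suc (m - Suc n)" using nm by simp
    then have "blinfun_apply shift ^^ m = (blinfun_apply shift ^^ n) \<circ> (blinfun_apply shift ^^ Suc (m - Suc n))"
      by (metis funpow_add)
    then show ?thesis by simp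
  qed
  then have "inner (h2_scaleC c ((blinfun_apply shift ^^ n) t)) (h2_scaleC d ((blinfun_apply shift ^^ m) t))
      = inner ((blinfun_apply shift ^^ n) t) ((blinfun_apply shift ^^ n) (shift h))"
    by (simp add: inner_h2_scaleC h_def shift_power_scaleC shift_scaleC)
  also have "\<dots> = 0" by (simp add: inner_shift_power orth \<open>h \<in> N\<close>)
  finally show ?thesis .
qed

lemma h2_fun_sum: "h2_fun (sum F A) z = (\<Sum>i\<in>A. h2_fun (F i) z)"
  by (induction A rule: infinite_finite_induct) (auto simp: zero_h2.rep_eq plus_h2.rep_eq)

text \<open>The product of \<open>t\<close> with the Taylor polynomial of \<open>f\<close> (\<open>h2_fun_polynomial_multiple\<close>),
  formed without knowing that \<open>t\<close> is bounded.\<close>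

definition polynomial_multiple :: "h2 \<Rightarrow> nat \<Rightarrow> h2 \<Rightarrow> h2" where
  "polynomial_multiple t N f = (\<Sum>n<N. h2_scaleC (h2_coeff f n) ((blinfun_apply shift ^^ n) t))"

lemma h2_fun_polynomial_multiple:
  assumes "z \<in> ball 0 1"
  shows "h2_fun (polynomial_multiple t N f) z = h2_fun t z * h2_fun (h2_trunc N f) z"
  unfolding polynomial_multiple_def h2_fun_sum h2_fun_trunc[OF assms]
  by (simp add: h2_scaleC.rep_eq h2_fun_shift_power sum_distrib_left mult_ac)

lemma polynomial_multiple_mem:
  assumes N: "invariant_subspace N" and t: "t \<in> N"
  shows "polynomial_multiple t n f \<in> N"
proof -
  have sub: "h2.subspace N" using N by (simp add: invariant_subspace_def)
  show ?thesis
    unfolding polynomial_multiple_def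
    using N t sub by (intro h2.subspace_sum h2.subspace_scale invariant_subspace_shift_power)
qed

lemma norm_shift_power: "norm ((blinfun_apply shift ^^ n) f) = norm f"
  by (simp add: norm_eq_sqrt_inner inner_shift_power)

lemma norm_polynomial_multiple:
  assumes N: "invariant_subspace N" and t: "t \<in> N" "norm t = 1" "\<And>h. h \<in> N \<Longrightarrow> inner t (shift h) = 0"
  shows "norm (polynomial_multiple t n f) = norm (h2_trunc n f)"
proof -
  have "(norm (polynomial_multiple t n f))\<^sup>2 =
      (\<Sum>i<n. (norm (h2_scaleC (h2_coeff f i) ((blinfun_apply shift ^^ i) t)))\<^sup>2)"
    unfolding polynomial_multiple_def
  proof (rule norm_sum_Pythagorean)
    show "pairwise (\<lambda>i j. orthogonal (h2_scaleC (h2_coeff f i) ((blinfun_apply shift ^^ i) t))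
        (h2_scaleC (h2_coeff f j) ((blinfun_apply shift ^^ j) t))) {..<n}"
      unfolding pairwise_def orthogonal_def
      using wandering_orthogonal[OF N t(1,3)] by (metis inner_commute linorder_neqE_nat)
  qed simp
  also have "\<dots> = (norm (h2_trunc n f))\<^sup>2"
    by (simp add: norm_h2_scaleC norm_shift_power t(2) norm_h2_trunc_sq)
  finally show ?thesis by (simp add: power2_eq_iff_nonneg)
qed

text \<open>The truncated kernel \<open>p\<close> at \<open>z\<close> has the value \<open>p z = \<parallel>p\<parallel>\<^sup>2\<close>. Evaluating \<open>t p\<close> at \<open>z\<close> gives
  \<open>\<bar>t z\<bar> \<parallel>p\<parallel>\<^sup>2 \<le> \<parallel>t p\<parallel> \<parallel>k\<parallel> = \<parallel>p\<parallel> \<parallel>k\<parallel>\<close> for the full kernel \<open>k\<close>, and \<open>\<parallel>p\<parallel>\<close> tends to \<open>\<parallel>k\<parallel>\<close>.\<close>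

lemma wandering_norm_le_1:
  assumes N: "invariant_subspace N" and t: "t \<in> N" "norm t = 1" "\<And>h. h \<in> N \<Longrightarrow> inner t (shift h) = 0"
    and z: "z \<in> ball 0 1"
  shows "norm (h2_fun t z) \<le> 1"
proof -
  define k where "k = h2_kernel z"
  define s where "s n = norm (h2_trunc n k)" for n
  have lim: "s \<longlonglongrightarrow> norm k"
    unfolding s_def by (intro tendsto_intros h2_trunc_tendsto)
  have "(norm (h2_coeff k 0))\<^sup>2 \<le> (norm k)\<^sup>2"
    by (intro power_mono norm_h2_coeff_le) simp
  then have k0: "norm k > 0"
    using z by (auto simp: k_def h2_coeff_kernel)
  have le: "norm (h2_fun t z) * (s n)\<^sup>2 \<le> s n * norm k" for n
  proof -
    have "h2_fun (h2_trunc n k) z = (\<Sum>i<n. of_real ((norm (cnj z ^ i))\<^sup>2))"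
      unfolding h2_fun_trunc[OF z] k_def h2_coeff_kernel[OF z] complex_norm_square by simp
    also have "\<dots> = of_real ((s n)\<^sup>2)"
      unfolding s_def norm_h2_trunc_sq of_real_sum k_def h2_coeff_kernel[OF z] ..
    finally have "norm (h2_fun t z) * (s n)\<^sup>2 = norm (h2_fun (polynomial_multiple t n k) z)"
      unfolding h2_fun_polynomial_multiple[OF z] norm_mult by (simp del: of_real_power)
    also have "\<dots> \<le> norm (polynomial_multiple t n k) * norm k"
      unfolding k_def by (rule norm_h2_fun_le[OF z])
    finally show ?thesis by (simp add: norm_polynomial_multiple[OF N t] s_def)
  qed
  have "norm (h2_fun t z) * (norm k)\<^sup>2 \<le> norm k * norm k"
    by (rule LIMSEQ_le[of "\<lambda>n. norm (h2_fun t z) * (s n)\<^sup>2" _ "\<lambda>n. s n * norm k"])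
      (use le in \<open>auto intro!: tendsto_intros lim\<close>)
  then show ?thesis using k0 by (simp add: power2_eq_square)
qed

lemma wandering_bounded:
  assumes "invariant_subspace N" "t \<in> N" "norm t = 1" "\<And>h. h \<in> N \<Longrightarrow> inner t (shift h) = 0"
  shows "h2_fun t \<in> H_infinity"
  using wandering_norm_le_1[OF assms]
  by (auto simp: H_infinity_def h2_fun_holomorphic bounded_iff intro!: exI[of _ 1])

lemma mult_op_trunc:
  assumes "h2_fun t \<in> H_infinity"
  shows "mult_op (h2_fun t) (h2_trunc n f) = polynomial_multiple t n f"
  by (rule h2_eqI) (simp add: mult_op_apply[OF assms] h2_fun_polynomial_multiple)

lemma polynomial_multiple_tendsto:
  assumes "h2_fun t \<in> H_infinity"
  shows "(\<lambda>n. polynomial_multiple t n f) \<longlonglongrightarrow> mult_op (h2_fun t) f"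
  unfolding mult_op_trunc[OF assms, symmetric] by (intro tendsto_intros h2_trunc_tendsto)

lemma mult_op_wandering_mem:
  assumes N: "invariant_subspace N" and t: "t \<in> N" "h2_fun t \<in> H_infinity"
  shows "mult_op (h2_fun t) f \<in> N"
  using closed_sequentially[OF _ _ polynomial_multiple_tendsto[OF t(2)], of N f]
    polynomial_multiple_mem[OF N t(1)] N by (auto simp: invariant_subspace_def)

lemma mult_op_wandering_isometry:
  assumes "invariant_subspace N" "t \<in> N" "norm t = 1" "\<And>h. h \<in> N \<Longrightarrow> inner t (shift h) = 0"
  shows "norm (mult_op (h2_fun t) f) = norm f"
proof (rule LIMSEQ_unique)
  show "(\<lambda>n. norm (polynomial_multiple t n f)) \<longlonglongrightarrow> norm (mult_op (h2_fun t) f)"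
    by (intro tendsto_intros polynomial_multiple_tendsto wandering_bounded[OF assms])
  show "(\<lambda>n. norm (polynomial_multiple t n f)) \<longlonglongrightarrow> norm f"
    by (simp add: norm_polynomial_multiple[OF assms] tendsto_norm h2_trunc_tendsto)
qed


section \<open>Invariant subspaces are ranges of multiplications\<close>

lemma mult_op_scaleC:
  assumes "\<phi> \<in> H_infinity"
  shows "mult_op \<phi> (h2_scaleC c f) = h2_scaleC c (mult_op \<phi> f)"
  using mult_op_in_L_H2[OF assms] by (simp add: L_H2_def)

lemma mult_op_shift:
  assumes "\<phi> \<in> H_infinity"
  shows "mult_op \<phi> (shift f) = shift (mult_op \<phi> f)"
  by (rule h2_eqI) (simp add: mult_op_apply[OF assms] shift_apply)

lemma closed_image_isometry:
  fixes T :: "'a::banach \<Rightarrow> 'b::banach"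
  assumes "bounded_linear T" "\<And>f. norm (T f) = norm f" "closed W" "subspace W"
  shows "closed (T ` W)"
  using complete_isometric_image[of 1 W T] assms by (simp add: complete_eq_closed)

lemma backward_shift_exists:
  obtains f1 where "\<And>z. z \<in> ball 0 1 \<Longrightarrow> h2_fun f z = h2_coeff f 0 + z * h2_fun f1 z"
proof
  define f1 where "f1 = h2_of_coeff (\<lambda>n. h2_coeff f (Suc n))"
  have s: "summable (\<lambda>n. (norm (h2_coeff f (Suc n)))\<^sup>2)"
    using summable_h2_coeff[of f] by (subst summable_Suc_iff)
  fix z :: complex assume z: "z \<in> ball 0 1"
  have "(\<lambda>n. h2_coeff f (Suc n) * z ^ Suc n) sums (z * h2_fun f1 z)"
    using sums_mult[OF h2_fun_of_coeff[OF s z], of z] by (simp add: f1_def mult_ac)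
  from sums_Suc[OF this]
  have "(\<lambda>n. h2_coeff f n * z ^ n) sums (z * h2_fun f1 z + h2_coeff f 0)" by simp
  from sums_unique2[OF h2_fun_sums[OF z] this]
  show "h2_fun f z = h2_coeff f 0 + z * h2_fun f1 z" by simp
qed

text \<open>Beurling's theorem. Multiplication by a wandering unit vector has closed range \<open>R\<close> inside \<open>N\<close>. A nonzero
  complement of \<open>R\<close> in \<open>N\<close> would be invariant, hence have a wandering unit vector of its own, and the product of
  the two vectors would be a unit vector orthogonal to itself.\<close>

theorem invariant_subspace_eq_range_mult_op:
  assumes N: "invariant_subspace N" and ne: "N \<noteq> {0}"
  obtains \<theta> where "\<theta> \<in> H_infinity" "\<And>f. norm (mult_op \<theta> f) = norm f" "N = range (mult_op \<theta>)"
proof -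
  have sub: "h2.subspace N" and cl: "closed N" and inv: "\<And>f. f \<in> N \<Longrightarrow> shift f \<in> N"
    using N by (auto simp: invariant_subspace_def)
  obtain t where t: "t \<in> N" "norm t = 1" "\<And>h. h \<in> N \<Longrightarrow> inner t (shift h) = 0"
    using wandering_vector_exists[OF N ne] by blast
  define \<theta> where "\<theta> = h2_fun t"
  have \<theta>: "\<theta> \<in> H_infinity" unfolding \<theta>_def by (rule wandering_bounded[OF N t])
  have iso: "norm (mult_op \<theta> f) = norm f" for f
    unfolding \<theta>_def by (rule mult_op_wandering_isometry[OF N t])
  define R where "R = range (mult_op \<theta>)"
  have RN: "R \<subseteq> N"
    using mult_op_wandering_mem[OF N t(1)] \<theta> by (auto simp: R_def \<theta>_def)
  have "closed R" unfolding R_def by (rule closed_image_isometry[OF blinfun.bounded_linear_right iso]) auto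
  have "subspace R"
    unfolding R_def by (intro linear_subspace_image bounded_linear.linear blinfun.bounded_linear_right) simp
  define N' where "N' = {g \<in> N. \<forall>u\<in>R. inner g u = 0}"
  have N': "invariant_subspace N'"
    unfolding invariant_subspace_def
  proof (intro conjI ballI)
    have "N' = N \<inter> (\<Inter>u\<in>R. {g. inner g u = 0})" by (auto simp: N'_def)
    moreover have "closed \<dots>"
      by (intro closed_Int cl closed_INT ballI closed_Collect_eq continuous_intros)
    ultimately show "closed N'" by simp
    show "h2.subspace N'"
    proof (rule h2.subspaceI)
      fix c x assume x: "x \<in> N'"
      have "inner (h2_scaleC c x) u = 0" if "u \<in> R" for u
      proof -
        have "h2_scaleC (cnj c) u \<in> R"
          using that unfolding R_def by (auto simp flip: mult_op_scaleC[OF \<theta>])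
        with x show ?thesis by (simp add: N'_def inner_h2_scaleC)
      qed
      with x show "h2_scaleC c x \<in> N'"
        using h2.subspace_scale[OF sub] by (auto simp: N'_def)
    qed (use h2.subspace_0[OF sub] h2.subspace_add[OF sub] in \<open>auto simp: N'_def inner_add_left\<close>)
    fix g assume g: "g \<in> N'"
    \<comment> \<open>An element of \<open>R\<close> is a multiple of \<open>t\<close> plus the shift of an element of \<open>R\<close>. The first part is
      orthogonal to shifted elements of \<open>N\<close>, and the shift can be cancelled against the second.\<close>
    have "inner (shift g) u = 0" if u: "u \<in> R" for u
    proof -
      obtain f where f: "u = mult_op \<theta> f" using u by (auto simp: R_def)
      obtain f1 where f1: "\<And>z. z \<in> ball 0 1 \<Longrightarrow> h2_fun f z = h2_coeff f 0 + z * h2_fun f1 z"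
        using backward_shift_exists by blast
      have eq: "u = h2_scaleC (h2_coeff f 0) t + shift (mult_op \<theta> f1)"
        by (rule h2_eqI)
          (simp add: f mult_op_apply[OF \<theta>] plus_h2.rep_eq h2_scaleC.rep_eq shift_apply f1
            algebra_simps flip: \<theta>_def)
      have "inner (shift g) (h2_scaleC (h2_coeff f 0) t) = inner t (shift (h2_scaleC (cnj (h2_coeff f 0)) g))"
        by (simp add: inner_commute[of "shift g"] inner_h2_scaleC shift_scaleC)
      also have "\<dots> = 0"
        using g h2.subspace_scale[OF sub] by (intro t(3)) (auto simp: N'_def)
      finally show ?thesis
        using g by (simp add: eq inner_add_right inner_shift N'_def R_def)
    qed
    with g inv show "shift g \<in> N'" by (auto simp: N'_def)
  qed
  have "N' = {0}"
  proof (rule ccontr)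
    assume "N' \<noteq> {0}"
    then obtain s where s: "s \<in> N'" "norm s = 1" "\<And>h. h \<in> N' \<Longrightarrow> inner s (shift h) = 0"
      using wandering_vector_exists[OF N'] by blast
    have \<phi>: "h2_fun s \<in> H_infinity" by (rule wandering_bounded[OF N' s])
    define x where "x = mult_op (h2_fun s) t"
    \<comment> \<open>The product of the two wandering vectors lies in both subspaces by commutativity.\<close>
    have "x = mult_op \<theta> s"
      unfolding x_def
      by (rule h2_eqI) (simp add: mult_op_apply[OF \<theta>] mult_op_apply[OF \<phi>], simp add: \<theta>_def)
    then have "x \<in> R" by (simp add: R_def)
    moreover have "x \<in> N'" unfolding x_def by (rule mult_op_wandering_mem[OF N' s(1) \<phi>])
    ultimately have "inner x x = 0" by (simp add: N'_def)
    moreover have "norm x = 1"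
      unfolding x_def by (simp add: mult_op_wandering_isometry[OF N' s] t(2))
    ultimately show False by (simp add: norm_eq_sqrt_inner)
  qed
  have "N \<subseteq> R"
  proof
    fix g assume g: "g \<in> N"
    obtain v where v: "v \<in> R" "\<And>u. u \<in> R \<Longrightarrow> inner (g - v) u = 0"
      using orthogonal_projection_exists[OF \<open>closed R\<close> \<open>subspace R\<close>] by blast
    then have "g - v \<in> N'"
      using g RN h2.subspace_diff[OF sub] by (auto simp: N'_def)
    with \<open>N' = {0}\<close> v(1) show "g \<in> R" by simp
  qed
  with RN have "N = range (mult_op \<theta>)" by (auto simp: R_def)
  with \<theta> iso that show ?thesis by blast
qed


section \<open>Differentiation almost everywhere of limits in variation\<close>

text \<open>Only finitely many disjoint closed intervals inside the open interval enter. These are the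
  intervals that a Vitali covering supplies.\<close>

definition variation_at_most :: "(real \<Rightarrow> 'a::real_normed_vector) \<Rightarrow> real \<Rightarrow> real \<Rightarrow> real \<Rightarrow> bool" where
  "variation_at_most H a b e \<longleftrightarrow>
     (\<forall>I. finite I \<and> (\<forall>(u, v)\<in>I. a < u \<and> u < v \<and> v < b) \<and>
        pairwise (\<lambda>i j. disjnt {fst i..snd i} {fst j..snd j}) I \<longrightarrow>
        (\<Sum>(u, v)\<in>I. norm (H v - H u)) \<le> e)"

text \<open>The steep points are covered in Vitali's sense by arbitrarily short intervals on which \<open>H\<close> grows by more than
  \<open>c\<close> times the length. For a disjoint subfamily the total length is at most the variation divided by \<open>c\<close>.\<close>

lemma steep_points_outer_measure:
  fixes H :: "real \<Rightarrow> 'a::real_normed_vector"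
  assumes var: "variation_at_most H a b e" and c: "c > 0"
  defines "E \<equiv> {t\<in>{a<..<b}. \<forall>d>0. \<exists>h. 0 < \<bar>h\<bar> \<and> \<bar>h\<bar> < d \<and> norm (H (t + h) - H t) > c * \<bar>h\<bar>}"
  shows "\<exists>T. E \<subseteq> T \<and> T \<in> lmeasurable \<and> measure lebesgue T \<le> e / c"
proof -
  define K where "K = {(u, v). a < u \<and> u < v \<and> v < b \<and> norm (H v - H u) > c * (v - u)}"
  \<comment> \<open>Intervals are presented as closed balls, with midpoint \<open>m\<close> and half length \<open>r\<close>.\<close>
  define m r :: "real \<times> real \<Rightarrow> real" where "m i = (fst i + snd i) / 2" and "r i = (snd i - fst i) / 2" for i
  have ball_eq: "cball (m i) (r i) = {fst i..snd i}" for i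
    by (simp add: cball_eq_atLeastAtMost m_def r_def field_simps)
  have K0: "\<And>i. i \<in> K \<Longrightarrow> 0 < r i" by (auto simp: K_def r_def)
  have cov: "\<exists>i. i \<in> K \<and> t \<in> cball (m i) (r i) \<and> r i < d" if t: "t \<in> E" and d: "0 < d" for t d
  proof -
    define d' where "d' = min d (min (t - a) (b - t))"
    have "d' > 0" using t d by (auto simp: d'_def E_def)
    then obtain h where h: "0 < \<bar>h\<bar>" "\<bar>h\<bar> < d'" "norm (H (t + h) - H t) > c * \<bar>h\<bar>"
      using t unfolding E_def by blast
    define i where "i = (min t (t + h), max t (t + h))"
    have "a < t" "t < b" "\<bar>h\<bar> < t - a" "\<bar>h\<bar> < b - t" "\<bar>h\<bar> < d"
      using t h(2) by (auto simp: d'_def E_def)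
    then have "i \<in> K"
      using h(1,3) by (auto simp: K_def i_def min_def max_def norm_minus_commute)
    moreover have "t \<in> cball (m i) (r i)" unfolding ball_eq by (simp add: i_def)
    moreover have "r i < d" using h by (auto simp: r_def i_def d'_def min_def max_def abs_if split: if_splits)
    ultimately show ?thesis by blast
  qed
  obtain C where C: "countable C" "C \<subseteq> K"
     "pairwise (\<lambda>i j. disjnt (cball (m i) (r i)) (cball (m j) (r j))) C"
     "negligible (E - (\<Union>i \<in> C. cball (m i) (r i)))"
    by (rule Vitali_covering_theorem_cballs[of K r E m, OF K0 cov])
  define U where "U = (\<Union>i \<in> C. cball (m i) (r i))"
  have fin: "measure lebesgue (\<Union>i\<in>I. cball (m i) (r i)) \<le> e / c" if I: "I \<subseteq> C" "finite I" for I
  proof -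
    have "measure lebesgue (\<Union>i\<in>I. cball (m i) (r i)) \<le> (\<Sum>i\<in>I. measure lebesgue (cball (m i) (r i)))"
      using I(2) by (intro measure_UNION_le) auto
    also have "\<dots> \<le> (\<Sum>i\<in>I. norm (H (snd i) - H (fst i)) / c)"
    proof (rule sum_mono)
      fix i assume "i \<in> I"
      then have "i \<in> K" using I C by blast
      then show "measure lebesgue (cball (m i) (r i)) \<le> norm (H (snd i) - H (fst i)) / c"
        unfolding ball_eq using c by (auto simp: K_def field_simps)
    qed
    also have "\<dots> = (\<Sum>(u, v)\<in>I. norm (H v - H u)) / c"
      by (simp add: sum_divide_distrib case_prod_unfold)
    also have "(\<Sum>(u, v)\<in>I. norm (H v - H u)) \<le> e"
    proof -
      have "\<forall>(u, v)\<in>I. a < u \<and> u < v \<and> v < b" using I C(2) by (auto simp: K_def)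
      moreover have "pairwise (\<lambda>i j. disjnt {fst i..snd i} {fst j..snd j}) I"
        using pairwise_subset[OF C(3) I(1)] by (simp add: ball_eq)
      ultimately show ?thesis using var I(2) unfolding variation_at_most_def by blast
    qed
    finally show ?thesis using c by (simp add: divide_right_mono)
  qed
  have U: "U \<in> lmeasurable" "measure lebesgue U \<le> e / c"
    unfolding U_def
    using fmeasurable_UN_bound[OF C(1) _ fin] measure_UN_bound[OF C(1) _ fin] by auto
  have N: "E - U \<in> lmeasurable" "measure lebesgue (E - U) = 0"
    using C(4) negligible_iff_measure unfolding U_def by blast+
  have "measure lebesgue (U \<union> (E - U)) \<le> measure lebesgue U + measure lebesgue (E - U)"
    using U N by (intro measure_Un_le) auto
  then have "measure lebesgue (U \<union> (E - U)) \<le> e / c" using U(2) N(2) by linarith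
  moreover have "U \<union> (E - U) \<in> lmeasurable" by (rule fmeasurable.Un[OF U(1) N(1)])
  moreover have "E \<subseteq> U \<union> (E - U)" by blast
  ultimately show ?thesis by blast
qed

text \<open>The derivatives at \<open>t\<close> of the approximants \<open>P\<close> form a Cauchy sequence as the slope bound \<open>e\<close> tends to 0,
  and their limit is the derivative of \<open>g\<close>.\<close>

lemma differentiable_of_small_slope_remainder:
  fixes g :: "real \<Rightarrow> 'a::banach"
  assumes approx: "\<And>e. e > 0 \<Longrightarrow> \<exists>P. P differentiable (at t) \<and>
      (\<exists>d>0. \<forall>h. \<bar>h\<bar> < d \<longrightarrow> norm ((g (t + h) - P (t + h)) - (g t - P t)) \<le> e * \<bar>h\<bar>)"
  shows "g differentiable (at t)"
proof -
  have "\<exists>D. \<exists>d>0. \<forall>h. \<bar>h\<bar> < d \<longrightarrow> norm (g (t + h) - g t - h *\<^sub>R D) \<le> e * \<bar>h\<bar>" if e: "e > 0" for e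
  proof -
    obtain P d where P: "P differentiable (at t)" and d: "d > 0"
      "\<And>h. \<bar>h\<bar> < d \<Longrightarrow> norm ((g (t + h) - P (t + h)) - (g t - P t)) \<le> e / 2 * \<bar>h\<bar>"
      using approx[of "e / 2"] e by auto
    obtain D where "(P has_vector_derivative D) (at t)"
      using P vector_derivative_works by blast
    then obtain d' where d': "d' > 0"
      "\<And>y. norm (y - t) < d' \<Longrightarrow> norm (P y - P t - (y - t) *\<^sub>R D) \<le> e / 2 * norm (y - t)"
      using e unfolding has_vector_derivative_def has_derivative_at_alt
      by (meson half_gt_zero)
    have "norm (g (t + h) - g t - h *\<^sub>R D) \<le> e * \<bar>h\<bar>" if "\<bar>h\<bar> < min d d'" for h
    proof -
      have "g (t + h) - g t - h *\<^sub>R D =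
          ((g (t + h) - P (t + h)) - (g t - P t)) + (P (t + h) - P t - h *\<^sub>R D)" by simp
      then have "norm (g (t + h) - g t - h *\<^sub>R D) \<le>
          norm ((g (t + h) - P (t + h)) - (g t - P t)) + norm (P (t + h) - P t - h *\<^sub>R D)"
        by (metis norm_triangle_ineq)
      also have "\<dots> \<le> e / 2 * \<bar>h\<bar> + e / 2 * \<bar>h\<bar>"
        using d(2)[of h] d'(2)[of "t + h"] that by (intro add_mono) auto
      finally show ?thesis by simp
    qed
    then show ?thesis
      using d(1) d'(1) by (intro exI[of _ D] exI[of _ "min d d'"]) auto
  qed
  from this[of "1 / Suc n" for n :: nat]
  have "\<forall>n. \<exists>D. \<exists>d>0. \<forall>h. \<bar>h\<bar> < d \<longrightarrow> norm (g (t + h) - g t - h *\<^sub>R D) \<le> 1 / Suc n * \<bar>h\<bar>"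
    by simp
  then obtain D where "\<forall>n. \<exists>d>0. \<forall>h. \<bar>h\<bar> < d \<longrightarrow> norm (g (t + h) - g t - h *\<^sub>R D n) \<le> 1 / Suc n * \<bar>h\<bar>"
    by metis
  then obtain d where d: "\<And>n. d n > 0"
    "\<And>n h. \<bar>h\<bar> < d n \<Longrightarrow> norm (g (t + h) - g t - h *\<^sub>R D n) \<le> 1 / Suc n * \<bar>h\<bar>"
    by metis
  have DD: "norm (D m - D n) \<le> 1 / Suc m + 1 / Suc n" for m n
  proof -
    define h where "h = min (d m) (d n) / 2"
    have h: "h > 0" "\<bar>h\<bar> < d m" "\<bar>h\<bar> < d n"
      using d(1)[of m] d(1)[of n] by (auto simp: h_def min_def)
    have "h * norm (D m - D n) = norm ((g (t + h) - g t - h *\<^sub>R D n) - (g (t + h) - g t - h *\<^sub>R D m))"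
      using h(1) by (simp add: algebra_simps flip: scaleR_diff_right)
    also have "\<dots> \<le> 1 / Suc n * \<bar>h\<bar> + 1 / Suc m * \<bar>h\<bar>"
      using d(2)[OF h(2)] d(2)[OF h(3)] norm_triangle_ineq4 by (smt (verit))
    also have "\<dots> = h * (1 / Suc m + 1 / Suc n)" using h(1) by (simp add: algebra_simps)
    finally show ?thesis using h(1) by (simp only: mult_le_cancel_left_pos)
  qed
  have small: "\<exists>N. \<forall>n\<ge>N. 1 / Suc n < e" if "e > 0" for e :: real
    using order_tendstoD(2)[OF LIMSEQ_inverse_real_of_nat that]
    by (simp add: eventually_sequentially inverse_eq_divide)
  have "Cauchy D"
  proof (rule metric_CauchyI)
    fix e :: real assume "e > 0"
    then obtain N where N: "\<And>n. n \<ge> N \<Longrightarrow> 1 / Suc n < e / 2" using small[of "e / 2"] by auto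
    have "dist (D m) (D n) < e" if "m \<ge> N" "n \<ge> N" for m n
      using DD[of m n] N[OF that(1)] N[OF that(2)] by (simp add: dist_norm)
    then show "\<exists>M. \<forall>m\<ge>M. \<forall>n\<ge>M. dist (D m) (D n) < e" by blast
  qed
  then obtain L where L: "D \<longlonglongrightarrow> L" using Cauchy_convergent convergent_def by blast
  have DL: "norm (D m - L) \<le> 1 / Suc m" for m
  proof (rule LIMSEQ_le)
    show "(\<lambda>n. norm (D m - D n)) \<longlonglongrightarrow> norm (D m - L)" by (intro tendsto_intros L)
    show "(\<lambda>n. 1 / Suc m + 1 / Suc n) \<longlonglongrightarrow> 1 / Suc m"
      using tendsto_add[OF tendsto_const LIMSEQ_inverse_real_of_nat, of "1 / Suc m"]
      by (simp add: inverse_eq_divide)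
  qed (use DD in blast)
  have "(g has_vector_derivative L) (at t)"
    unfolding has_vector_derivative_def has_derivative_at_alt
  proof (intro conjI allI impI)
    show "bounded_linear (\<lambda>x. x *\<^sub>R L)" by (rule bounded_linear_scaleR_left)
    fix e :: real assume "e > 0"
    then obtain n where n: "1 / Suc n < e / 2" using small[of "e / 2"] by auto
    have "norm (g y - g t - (y - t) *\<^sub>R L) \<le> e * norm (y - t)" if y: "norm (y - t) < d n" for y
    proof -
      have "g y - g t - (y - t) *\<^sub>R L = (g y - g t - (y - t) *\<^sub>R D n) + (y - t) *\<^sub>R (D n - L)"
        by (simp add: algebra_simps)
      then have "norm (g y - g t - (y - t) *\<^sub>R L) \<le>
          norm (g y - g t - (y - t) *\<^sub>R D n) + norm ((y - t) *\<^sub>R (D n - L))"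
        by (metis norm_triangle_ineq)
      also have "\<dots> \<le> 1 / Suc n * \<bar>y - t\<bar> + \<bar>y - t\<bar> * (1 / Suc n)"
        using d(2)[of "y - t" n] y mult_left_mono[OF DL[of n], of "\<bar>y - t\<bar>"]
        by (intro add_mono) auto
      also have "\<dots> = \<bar>y - t\<bar> * (2 * (1 / Suc n))" by simp
      also have "\<dots> \<le> \<bar>y - t\<bar> * e" using n by (intro mult_left_mono) auto
      finally show ?thesis by (simp add: mult.commute)
    qed
    then show "\<exists>da>0. \<forall>y. norm (y - t) < da \<longrightarrow> norm (g y - g t - (y - t) *\<^sub>R L) \<le> e * norm (y - t)"
      using d(1)[of n] by blast
  qed
  then show ?thesis by (rule differentiableI_vector)
qed

text \<open>At a point where \<open>g\<close> is not differentiable, some slope bound is violated by \<open>g - P\<close> for every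
  approximant \<open>P\<close>. For a fixed bound such points have outer measure at most a constant times the variation of
  \<open>g - P\<close>, which can be made as small as desired.\<close>

theorem differentiable_ae_of_variation_limit:
  fixes g :: "real \<Rightarrow> 'a::banach"
  assumes approx: "\<And>e. e > 0 \<Longrightarrow> \<exists>P. (\<forall>t. P differentiable (at t)) \<and> variation_at_most (\<lambda>t. g t - P t) a b e"
  shows "negligible {t\<in>{a<..<b}. \<not> g differentiable (at t)}"
proof -
  define A where "A n = {t\<in>{a<..<b}. \<forall>P. (\<forall>s. P differentiable (at s)) \<longrightarrow>
      (\<forall>d>0. \<exists>h. 0 < \<bar>h\<bar> \<and> \<bar>h\<bar> < d \<and>
         norm ((g (t + h) - P (t + h)) - (g t - P t)) > 1 / Suc n * \<bar>h\<bar>)}" for n :: nat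
  have "negligible (A n)" for n
    unfolding negligible_outer_le
  proof (intro allI impI)
    fix e :: real assume "e > 0"
    then obtain P where P: "\<forall>t. P differentiable (at t)" "variation_at_most (\<lambda>t. g t - P t) a b (e / Suc n)"
      using approx[of "e / Suc n"] by auto
    have "A n \<subseteq> {t\<in>{a<..<b}. \<forall>d>0. \<exists>h. 0 < \<bar>h\<bar> \<and> \<bar>h\<bar> < d \<and>
        norm ((g (t + h) - P (t + h)) - (g t - P t)) > 1 / Suc n * \<bar>h\<bar>}"
      using P(1) by (auto simp: A_def)
    moreover obtain T where "{t\<in>{a<..<b}. \<forall>d>0. \<exists>h. 0 < \<bar>h\<bar> \<and> \<bar>h\<bar> < d \<and>
        norm ((g (t + h) - P (t + h)) - (g t - P t)) > 1 / Suc n * \<bar>h\<bar>} \<subseteq> T"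
        "T \<in> lmeasurable" "measure lebesgue T \<le> e / Suc n / (1 / Suc n)"
      using steep_points_outer_measure[OF P(2), of "1 / Suc n"] by auto
    ultimately show "\<exists>T. A n \<subseteq> T \<and> T \<in> lmeasurable \<and> measure lebesgue T \<le> e"
      by (intro exI[of _ T]) simp
  qed
  moreover have "{t\<in>{a<..<b}. \<not> g differentiable (at t)} \<subseteq> (\<Union>n. A n)"
  proof (rule ccontr)
    assume "\<not> ?thesis"
    then obtain t where t: "t \<in> {a<..<b}" "\<not> g differentiable (at t)" "\<And>n. t \<notin> A n" by blast
    have "g differentiable (at t)"
    proof (rule differentiable_of_small_slope_remainder)
      fix e :: real assume "e > 0"
      then obtain n where n: "1 / Suc n < e" by (metis nat_approx_posE)
      obtain P d where P: "\<forall>s. P differentiable (at s)" and d: "d > 0"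
        and le: "\<And>h. 0 < \<bar>h\<bar> \<Longrightarrow> \<bar>h\<bar> < d \<Longrightarrow>
         norm ((g (t + h) - P (t + h)) - (g t - P t)) \<le> 1 / Suc n * \<bar>h\<bar>"
        using t(1) t(3)[of n] unfolding A_def mem_Collect_eq not_less[symmetric] by blast
      have "norm ((g (t + h) - P (t + h)) - (g t - P t)) \<le> e * \<bar>h\<bar>" if "\<bar>h\<bar> < d" for h
      proof (cases "h = 0")
        case False
        then have "norm ((g (t + h) - P (t + h)) - (g t - P t)) \<le> 1 / Suc n * \<bar>h\<bar>"
          using le that by simp
        also have "\<dots> \<le> e * \<bar>h\<bar>" using n by (intro mult_right_mono) auto
        finally show ?thesis .
      qed simp
      with P d show "\<exists>P. P differentiable (at t) \<and>
          (\<exists>d>0. \<forall>h. \<bar>h\<bar> < d \<longrightarrow> norm ((g (t + h) - P (t + h)) - (g t - P t)) \<le> e * \<bar>h\<bar>)"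
        by blast
    qed
    with t(2) show False ..
  qed
  ultimately show ?thesis
    using negligible_Union_nat negligible_subset by blast
qed


section \<open>Boundary variation of a primitive\<close>

text \<open>A fixed sequence of radii, so that the dominated convergence theorems for sequences apply.\<close>

definition radius :: "nat \<Rightarrow> real" where
  "radius n = 1 - 1 / Suc (Suc n)"

lemma radius_bounds: "0 < radius n" "radius n < 1"
  by (simp_all add: radius_def)

lemma radius_tendsto: "radius \<longlonglongrightarrow> 1"
proof -
  have "(\<lambda>n. 1 / real (Suc (Suc n))) \<longlonglongrightarrow> 0"
    using LIMSEQ_Suc[OF LIMSEQ_inverse_real_of_nat] by (simp add: inverse_eq_divide)
  from tendsto_diff[OF tendsto_const this, of 1] show ?thesis
    by (simp add: radius_def[abs_def])
qed

lemma radial_tendsto: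
  fixes w :: complex
  assumes "continuous_on (cball 0 1) H" "norm w = 1"
  shows "(\<lambda>n. H (of_real (radius n) * w)) \<longlonglongrightarrow> H w"
proof (rule continuous_on_tendsto_compose[OF assms(1)])
  have "(\<lambda>n. of_real (radius n) * w) \<longlonglongrightarrow> of_real 1 * w"
    by (intro tendsto_intros radius_tendsto)
  then show "(\<lambda>n. of_real (radius n) * w) \<longlonglongrightarrow> w" by simp
  show "\<forall>\<^sub>F n in sequentially. of_real (radius n) * w \<in> cball 0 1"
    using assms(2) radius_bounds by (auto simp: norm_mult less_imp_le intro!: always_eventually)
qed (use assms in auto)

text \<open>On the circle of radius \<open>r < 1\<close> the increments of \<open>H\<close> are integrals of \<open>h\<close>, and Parseval's identity
  bounds the integral of \<open>\<bar>h\<bar>\<close> by \<open>2 \<pi>\<close> times the \<open>H\<^sup>2\<close> norm, independently of \<open>r\<close>. Continuity of \<open>H\<close> on the closed disc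
  gives the bound for \<open>r = 1\<close>.\<close>

lemma primitive_boundary_variation:
  assumes cont: "continuous_on (cball 0 1) H"
    and der: "\<And>z. z \<in> ball 0 1 \<Longrightarrow> (H has_field_derivative h z) (at z)"
    and hol: "h holomorphic_on ball 0 1"
    and sq: "summable (\<lambda>n. (norm (taylor_coeff h n))\<^sup>2)" "(\<Sum>n. (norm (taylor_coeff h n))\<^sup>2) \<le> s\<^sup>2"
    and s: "s > 0"
  shows "variation_at_most (\<lambda>t. H (cis t)) 0 (2 * pi) (2 * pi * s)"
  unfolding variation_at_most_def
proof (intro allI impI, elim conjE)
  fix I :: "(real \<times> real) set"
  assume fin: "finite I" and ord: "\<forall>(u, v)\<in>I. 0 < u \<and> u < v \<and> v < 2 * pi"
    and dis: "pairwise (\<lambda>i j. disjnt {fst i..snd i} {fst j..snd j}) I"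
  have le: "(\<Sum>(u, v)\<in>I. norm (H (of_real r * cis v) - H (of_real r * cis u))) \<le> 2 * pi * s"
    if r: "0 < r" "r < 1" for r :: real
  proof -
    \<comment> \<open>A majorant of \<open>\<bar>h\<bar>\<close> by the inequality \<open>2 s x \<le> s\<^sup>2 + x\<^sup>2\<close>, in place of the
      Cauchy-Schwarz inequality.\<close>
    define \<phi> where "\<phi> t = s / 2 + (norm (h (of_real r * cis t)))\<^sup>2 / (2 * s)" for t
    note pv = parseval[OF hol r]
    have \<phi>_int: "\<phi> integrable_on {0..2 * pi}"
      unfolding \<phi>_def[abs_def] by (intro integrable_add integrable_on_divide pv(1)) auto
    have "integral {0..2 * pi} \<phi> = 2 * pi * (s / 2) +
        integral {0..2 * pi} (\<lambda>t. (norm (h (of_real r * cis t)))\<^sup>2) / (2 * s)"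
      unfolding \<phi>_def[abs_def]
      by (subst integral_add) (auto intro!: integrable_on_divide pv(1))
    also have "integral {0..2 * pi} (\<lambda>t. (norm (h (of_real r * cis t)))\<^sup>2) =
        2 * pi * (\<Sum>n. (norm (taylor_coeff h n))\<^sup>2 * r ^ (2 * n))"
      using sums_unique[OF pv(2)] by (simp add: field_simps)
    also have "(\<Sum>n. (norm (taylor_coeff h n))\<^sup>2 * r ^ (2 * n)) \<le> (\<Sum>n. (norm (taylor_coeff h n))\<^sup>2)"
      using r by (intro suminf_le sums_summable[OF pv(2)] sq(1)) (auto intro!: mult_left_le power_le_one)
    also note sq(2)
    finally have \<phi>_le: "integral {0..2 * pi} \<phi> \<le> 2 * pi * s"
      using s by (simp add: power2_eq_square divide_right_mono)
    have piece: "norm (H (of_real r * cis v) - H (of_real r * cis u)) \<le> integral {u..v} \<phi>"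
      "\<phi> integrable_on {u..v}"
      if uv: "(u, v) \<in> I" for u v
    proof -
      have b: "0 < u" "u < v" "v < 2 * pi" using ord uv by auto
      show i: "\<phi> integrable_on {u..v}"
        by (rule integrable_on_subinterval[OF \<phi>_int]) (use b in auto)
      define k where "k t = h (of_real r * cis t) * (of_real r * (\<i> * cis t))" for t
      have "(k has_integral (H (of_real r * cis v) - H (of_real r * cis u))) {u..v}"
      proof (rule fundamental_theorem_of_calculus)
        fix t :: real
        have "((\<lambda>t. of_real r * cis t) has_vector_derivative of_real r * (\<i> * cis t)) (at t within {u..v})"
        proof -
          have "((\<lambda>z. of_real r * exp (\<i> * z)) has_field_derivative of_real r * (\<i> * exp (\<i> * of_real t))) (at (of_real t))"
            by (auto intro!: derivative_eq_intros)
          from has_vector_derivative_real_field[OF this] show ?thesis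
            by (simp add: cis_conv_exp has_vector_derivative_at_within)
        qed
        moreover have "(H has_field_derivative h (of_real r * cis t)) (at (of_real r * cis t))"
          using r by (intro der) (simp add: norm_mult)
        ultimately have "((H \<circ> (\<lambda>t. of_real r * cis t)) has_vector_derivative
            (of_real r * (\<i> * cis t)) * h (of_real r * cis t)) (at t within {u..v})"
          by (rule field_vector_diff_chain_within[OF _ has_field_derivative_at_within])
        then show "((\<lambda>t. H (of_real r * cis t)) has_vector_derivative k t) (at t within {u..v})"
          by (simp add: o_def k_def mult.commute)
      qed (use b in simp)
      moreover have "norm (k t) \<le> \<phi> t" for t
      proof -
        define x where "x = norm (h (of_real r * cis t))"
        have "norm (k t) = x * r" using r by (simp add: k_def norm_mult x_def)
        also have "\<dots> \<le> x" using r by (intro mult_left_le) (auto simp: x_def)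
        also have "x \<le> s / 2 + x\<^sup>2 / (2 * s)"
          using s sum_squares_bound[of s x] by (simp add: field_simps power2_eq_square)
        finally show ?thesis by (simp add: \<phi>_def x_def)
      qed
      ultimately show "norm (H (of_real r * cis v) - H (of_real r * cis u)) \<le> integral {u..v} \<phi>"
        using integral_norm_bound_integral[of k "{u..v}" \<phi>] i
        by (auto simp: has_integral_integrable integral_unique)
    qed
    have "(\<Sum>(u, v)\<in>I. norm (H (of_real r * cis v) - H (of_real r * cis u))) \<le>
        (\<Sum>i\<in>I. integral {fst i..snd i} \<phi>)"
      using piece(1) by (intro sum_mono) auto
    also have U: "(\<phi> has_integral (\<Sum>i\<in>I. integral {fst i..snd i} \<phi>)) (\<Union>i\<in>I. {fst i..snd i})"
      using piece(2) dis fin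
      by (intro has_integral_UN integrable_integral) (auto simp: pairwise_def disjnt_def)
    then have "(\<Sum>i\<in>I. integral {fst i..snd i} \<phi>) = integral (\<Union>i\<in>I. {fst i..snd i}) \<phi>"
      by (simp add: integral_unique)
    also have "\<dots> \<le> integral {0..2 * pi} \<phi>"
      using ord U \<phi>_int s by (intro integral_subset_le) (fastforce simp: \<phi>_def has_integral_integrable)+
    also note \<phi>_le
    finally show ?thesis .
  qed
  have "(\<lambda>n. \<Sum>(u, v)\<in>I. norm (H (of_real (radius n) * cis v) - H (of_real (radius n) * cis u)))
      \<longlonglongrightarrow> (\<Sum>(u, v)\<in>I. norm (H (cis v) - H (cis u)))"
    unfolding case_prod_unfold by (intro tendsto_intros radial_tendsto cont) auto
  then show "(\<Sum>(u, v)\<in>I. norm (H (cis v) - H (cis u))) \<le> 2 * pi * s"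
    by (rule LIMSEQ_le_const2) (use le radius_bounds in blast)
qed


section \<open>From the circle to the disc\<close>

lemma circle_mean_value:
  assumes hol: "k holomorphic_on ball 0 1" and r: "0 < r" "r < 1"
  shows "((\<lambda>x. k (of_real r * cis (2 * pi * x))) has_integral k 0) {0..1}"
proof -
  have "k holomorphic_on cball 0 r" using r by (intro holomorphic_on_subset[OF hol]) auto
  then have "((\<lambda>u. k u / (u - 0)) has_contour_integral (2 * of_real pi * \<i> * k 0)) (circlepath 0 r)"
    using r by (intro Cauchy_integral_circlepath_simple) auto
  then have "((\<lambda>x. (2 * of_real pi * \<i>) * k (of_real r * cis (2 * pi * x))) has_integral (2 * of_real pi * \<i>) * k 0) {0..1}"
    unfolding has_contour_integral_def
  proof (rule has_integral_eq[rotated])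
    fix x :: real assume x: "x \<in> {0..1}"
    have e: "exp (2 * of_real pi * \<i> * of_real x) = cis (2 * pi * x)"
      by (simp add: cis_conv_exp mult_ac)
    show "k (circlepath 0 r x) / (circlepath 0 r x - 0) * vector_derivative (circlepath 0 r) (at x within {0..1}) =
        2 * of_real pi * \<i> * k (of_real r * cis (2 * pi * x))"
      using x r by (subst vector_derivative_circlepath01) (simp_all add: circlepath e)
  qed
  from has_integral_mult_right[OF this, of "1 / (2 * of_real pi * \<i>)"] show ?thesis
    by simp
qed

lemma finite_circle_fibre: "finite {x \<in> {0..1}. cis (2 * pi * x) = w}"
proof (rule finite_subset)
  show "{x \<in> {0..1}. cis (2 * pi * x) = w} \<subseteq> {Arg2pi w / (2 * pi), 1}"
  proof
    fix x assume "x \<in> {x \<in> {0..1}. cis (2 * pi * x) = w}"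
    then have x: "0 \<le> x" "x \<le> 1" "cis (2 * pi * x) = w" by auto
    show "x \<in> {Arg2pi w / (2 * pi), 1}"
    proof (cases "x = 1")
      case False
      have "Arg2pi w = 2 * pi * x"
        by (rule Arg2pi_unique[of 1]) (use x False in \<open>auto simp: cis_conv_exp\<close>)
      then show ?thesis by simp
    qed simp
  qed
qed simp

lemma Moebius_denominator_nonzero:
  assumes "norm z < 1" "norm w \<le> 1"
  shows "1 + cnj z * w \<noteq> (0::complex)"
proof
  assume "1 + cnj z * w = 0"
  then have "cnj z * w = - 1" by (simp add: add_eq_0_iff)
  then have "norm z * norm w = 1" by (metis complex_mod_cnj norm_minus_cancel norm_mult norm_one)
  moreover have "norm z * norm w \<le> norm z" using assms by (intro mult_left_le) auto
  ultimately show False using assms by simp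
qed

lemma Moebius_alt: "Moebius_function 0 (- z) w = (w + z) / (1 + cnj z * w)"
  by (simp add: Moebius_function_simple)

lemma norm_Moebius_circle:
  assumes "norm z < 1" "norm w = 1"
  shows "norm (Moebius_function 0 (- z) w) = 1"
proof -
  have "cnj w * w = 1" using assms(2) complex_norm_square[of w] by (simp add: mult.commute)
  then have "cnj w * (w + z) = cnj (1 + cnj z * w)" by (simp add: algebra_simps)
  then have "norm (w + z) = norm (1 + cnj z * w)"
    using assms(2) by (metis complex_mod_cnj mult_1 norm_mult)
  moreover have "1 + cnj z * w \<noteq> 0" using Moebius_denominator_nonzero assms by simp
  ultimately show ?thesis by (simp add: Moebius_alt norm_divide)
qed

text \<open>The mean value property of the composition with the disc automorphism that takes 0 to \<open>z\<close>, on circles of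
  radius tending to 1. A single boundary point, the preimage of \<open>\<zeta>\<close>, is lost in the limit; since \<open>q\<close> is
  bounded this does not affect the integral.\<close>

lemma Moebius_mean_value:
  assumes hol: "q holomorphic_on ball 0 1" and cont: "continuous_on (cball 0 1 - {\<zeta>}) q"
    and bd: "\<And>w. w \<in> cball 0 1 \<Longrightarrow> norm (q w) \<le> L"
    and z: "z \<in> ball 0 1"
  shows "((\<lambda>x. q (Moebius_function 0 (- z) (cis (2 * pi * x)))) has_integral q z) {0..1}"
proof -
  let ?M = "Moebius_function 0 (- z)"
  have nz: "norm z < 1" using z by simp
  define k where "k w = q (?M w)" for w
  have M_in: "?M w \<in> ball 0 1" if "norm w < 1" for w
    using Moebius_function_norm_lt_1[of "- z" w 0] nz that by simp
  have "k holomorphic_on ball 0 1"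
  proof -
    have "(q \<circ> ?M) holomorphic_on ball 0 1"
      by (rule holomorphic_on_compose_gen[OF Moebius_function_holomorphic hol]) (use nz M_in in auto)
    then show ?thesis by (simp add: k_def[abs_def] o_def)
  qed
  then have int: "((\<lambda>x. k (of_real (radius n) * cis (2 * pi * x))) has_integral k 0) {0..1}" for n
    using radius_bounds by (intro circle_mean_value)
  define X where "X = {x \<in> {0..1}. cis (2 * pi * x) = (\<zeta> - z) / (1 - cnj z * \<zeta>)}"
  define S where "S = {0..1} - X"
  have X: "finite X" unfolding X_def by (rule finite_circle_fibre)
  have SX: "(f has_integral y) S \<longleftrightarrow> (f has_integral y) {0..1}" for f :: "real \<Rightarrow> complex" and y
    by (intro has_integral_spike_set_eq negligible_subset[OF negligible_finite[OF X]]) (auto simp: S_def)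
  have "((\<lambda>x. q (?M (cis (2 * pi * x)))) has_integral k 0) S"
  proof (rule has_integral_dominated_convergence)
    show "((\<lambda>x. k (of_real (radius n) * cis (2 * pi * x))) has_integral k 0) S" for n
      unfolding SX by (rule int)
    have "((\<lambda>x. L) has_integral L * (1 - 0)) {0..1::real}" using has_integral_const_real[of L 0 1] by simp
    then have "((\<lambda>x. L) has_integral L) S"
      by (subst has_integral_spike_set_eq[of _ "{0..1}"])
        (auto simp: S_def intro: negligible_subset[OF negligible_finite[OF X]])
    then show "(\<lambda>x. L) integrable_on S" by blast
    show "\<forall>x\<in>S. norm (k (of_real (radius n) * cis (2 * pi * x))) \<le> L" for n
    proof
      fix x
      have "?M (of_real (radius n) * cis (2 * pi * x)) \<in> ball 0 1"
        using radius_bounds[of n] by (intro M_in) (simp add: norm_mult)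
      then show "norm (k (of_real (radius n) * cis (2 * pi * x))) \<le> L"
        unfolding k_def by (intro bd) auto
    qed
    show "\<forall>x\<in>S. (\<lambda>n. k (of_real (radius n) * cis (2 * pi * x))) \<longlonglongrightarrow> q (?M (cis (2 * pi * x)))"
    proof
      fix x assume x: "x \<in> S"
      define w where "w = cis (2 * pi * x)"
      have w: "norm w = 1" by (simp add: w_def)
      have den: "1 + cnj z * w \<noteq> 0" using Moebius_denominator_nonzero nz w by simp
      have ne: "?M w \<noteq> \<zeta>"
      proof
        assume "?M w = \<zeta>"
        then have "w + z = \<zeta> * (1 + cnj z * w)" using den by (simp add: Moebius_alt field_simps)
        then have eq: "w * (1 - cnj z * \<zeta>) = \<zeta> - z" by (simp add: algebra_simps)
        have "norm \<zeta> = 1" using \<open>?M w = \<zeta>\<close> norm_Moebius_circle[OF nz w] by simp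
        then have "1 - cnj z * \<zeta> \<noteq> 0" using Moebius_denominator_nonzero[of "- z" \<zeta>] nz by simp
        with eq have "w = (\<zeta> - z) / (1 - cnj z * \<zeta>)" by (simp add: field_simps)
        with x show False by (auto simp: S_def X_def w_def)
      qed
      have "(\<lambda>n. q (?M (of_real (radius n) * w))) \<longlonglongrightarrow> q (?M w)"
      proof (rule continuous_on_tendsto_compose[OF cont])
        have "(\<lambda>n. (of_real (radius n) * w + z) / (1 + cnj z * (of_real (radius n) * w)))
            \<longlonglongrightarrow> (of_real 1 * w + z) / (1 + cnj z * (of_real 1 * w))"
          using den by (intro tendsto_intros radius_tendsto) auto
        then show lim: "(\<lambda>n. ?M (of_real (radius n) * w)) \<longlonglongrightarrow> ?M w" by (simp add: Moebius_alt)
        show "?M w \<in> cball 0 1 - {\<zeta>}" using ne norm_Moebius_circle[OF nz w] by simp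
        have "\<forall>\<^sub>F n in sequentially. ?M (of_real (radius n) * w) \<noteq> \<zeta>"
          using lim ne by (rule tendsto_imp_eventually_ne)
        then show "\<forall>\<^sub>F n in sequentially. ?M (of_real (radius n) * w) \<in> cball 0 1 - {\<zeta>}"
        proof eventually_elim
          case (elim n)
          have "?M (of_real (radius n) * w) \<in> ball 0 1"
            using radius_bounds[of n] w by (intro M_in) (simp add: norm_mult)
          with elim show ?case by simp
        qed
      qed
      then show "(\<lambda>n. k (of_real (radius n) * cis (2 * pi * x))) \<longlonglongrightarrow> q (?M (cis (2 * pi * x)))"
        by (simp add: k_def w_def)
    qed
  qed auto
  moreover have "k 0 = q z" by (simp add: k_def Moebius_function_of_zero)
  ultimately show ?thesis by (simp add: SX)
qed

text \<open>As \<open>z\<close> tends to \<open>\<zeta>\<close>, the automorphism that takes 0 to \<open>z\<close> moves every point of the circle except \<open>- \<zeta>\<close> to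
  \<open>\<zeta>\<close>. Dominated convergence in the mean value formula for \<open>q z\<close> then gives the limit 0, for every
  approach of \<open>z\<close> from inside the disc.\<close>

lemma limit_in_disc_of_limit_on_circle:
  assumes hol: "q holomorphic_on ball 0 1" and cont: "continuous_on (cball 0 1 - {\<zeta>}) q"
    and bd: "\<And>w. w \<in> cball 0 1 \<Longrightarrow> norm (q w) \<le> L"
    and \<zeta>: "norm \<zeta> = 1" and q0: "q \<zeta> = 0" and lim: "(q \<longlongrightarrow> 0) (at \<zeta> within sphere 0 1)"
  shows "(q \<longlongrightarrow> 0) (at \<zeta> within ball 0 1)"
  unfolding tendsto_at_iff_sequentially
proof (intro allI impI)
  fix Z :: "nat \<Rightarrow> complex" assume Z: "\<forall>i. Z i \<in> ball 0 1 - {\<zeta>}" "Z \<longlonglongrightarrow> \<zeta>"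
  define F where "F n x = q (Moebius_function 0 (- Z n) (cis (2 * pi * x)))" for n x
  have int: "(F n has_integral q (Z n)) {0..1}" for n
    unfolding F_def[abs_def] by (rule Moebius_mean_value[OF hol cont bd]) (use Z in auto)
  define X where "X = {x \<in> {0..1}. cis (2 * pi * x) = - \<zeta>}"
  define S where "S = {0..1} - X"
  have X: "finite X" unfolding X_def by (rule finite_circle_fibre)
  have intS: "(F n has_integral q (Z n)) S" for n
    by (intro iffD2[OF has_integral_spike_set_eq int] negligible_subset[OF negligible_finite[OF X]])
      (auto simp: S_def)
  have "(\<lambda>n. integral S (F n)) \<longlonglongrightarrow> integral S (\<lambda>x. 0)"
  proof (rule dominated_convergence(2))
    show "F n integrable_on S" for n using intS by blast
    have "((\<lambda>x. L) has_integral L * (1 - 0)) {0..1::real}" using has_integral_const_real[of L 0 1] by simp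
    then have "((\<lambda>x. L) has_integral L) S"
      by (subst has_integral_spike_set_eq[of _ "{0..1}"])
        (auto simp: S_def intro: negligible_subset[OF negligible_finite[OF X]])
    then show "(\<lambda>x. L) integrable_on S" by blast
    have M1: "norm (Moebius_function 0 (- Z n) (cis (2 * pi * x))) = 1" for n x
      using Z by (intro norm_Moebius_circle) auto
    then show "norm (F n x) \<le> L" for n x
      unfolding F_def by (intro bd) simp
    have qc: "continuous_on (sphere 0 1) q"
      unfolding continuous_on_def
    proof
      fix w :: complex assume w: "w \<in> sphere 0 1"
      show "(q \<longlongrightarrow> q w) (at w within sphere 0 1)"
      proof (cases "w = \<zeta>")
        case False
        have "continuous_on (sphere 0 1 - {\<zeta>}) q"
          by (rule continuous_on_subset[OF cont]) auto
        then have "(q \<longlongrightarrow> q w) (at w within sphere 0 1 - {\<zeta>})"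
          using w False by (auto simp: continuous_on_def)
        moreover have "at w within sphere 0 1 - {\<zeta>} = at w within sphere 0 1"
          by (rule at_within_nhd[of _ "- {\<zeta>}"]) (use False in auto)
        ultimately show ?thesis by simp
      qed (use lim q0 in simp)
    qed
    fix x assume x: "x \<in> S"
    define w where "w = cis (2 * pi * x)"
    have w: "norm w = 1" "w \<noteq> - \<zeta>" using x by (auto simp: w_def S_def X_def)
    have zz: "\<zeta> * cnj \<zeta> = 1" using \<zeta> complex_norm_square[of \<zeta>] by simp
    have "\<zeta> * (1 + cnj \<zeta> * w) = \<zeta> + (\<zeta> * cnj \<zeta>) * w" by (simp add: algebra_simps)
    then have eq: "\<zeta> * (1 + cnj \<zeta> * w) = w + \<zeta>" unfolding zz by simp
    then have den: "1 + cnj \<zeta> * w \<noteq> 0" using w(2) by (auto simp: add_eq_0_iff)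
    have "(\<lambda>n. q (Moebius_function 0 (- Z n) w)) \<longlonglongrightarrow> q \<zeta>"
    proof (rule continuous_on_tendsto_compose[OF qc])
      have "(\<lambda>n. (w + Z n) / (1 + cnj (Z n) * w)) \<longlonglongrightarrow> (w + \<zeta>) / (1 + cnj \<zeta> * w)"
        using den by (intro tendsto_intros Z)
      also have "(w + \<zeta>) / (1 + cnj \<zeta> * w) = \<zeta>" using den by (simp add: eq[symmetric])
      finally show "(\<lambda>n. Moebius_function 0 (- Z n) w) \<longlonglongrightarrow> \<zeta>" by (simp add: Moebius_alt)
    qed (use \<zeta> M1 in \<open>auto simp: w_def\<close>)
    then show "(\<lambda>n. F n x) \<longlonglongrightarrow> 0" by (simp add: F_def q0 w_def)
  qed
  then show "(q \<circ> Z) \<longlonglongrightarrow> 0"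
    by (simp add: integral_unique[OF intS] o_def)
qed


section \<open>Nontangential limits almost everywhere\<close>

lemma vector_derivative_quotient_tendsto:
  fixes g :: "real \<Rightarrow> complex"
  assumes "(g has_vector_derivative D) (at t0)"
  shows "((\<lambda>t. (g t - g t0) / of_real (t - t0)) \<longlongrightarrow> D) (at t0)"
proof -
  have lim: "((\<lambda>t. norm (g t - g t0 - (t - t0) *\<^sub>R D) / norm (t - t0)) \<longlongrightarrow> 0) (at t0)"
    using assms unfolding has_vector_derivative_def has_derivative_iff_norm by blast
  have "((\<lambda>t. norm ((g t - g t0) / of_real (t - t0) - D)) \<longlongrightarrow> 0) (at t0)"
  proof (rule Lim_transform_eventually[OF lim])
    have "norm (g t - g t0 - (t - t0) *\<^sub>R D) / norm (t - t0) = norm ((g t - g t0) / of_real (t - t0) - D)"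
      if "t \<noteq> t0" for t
    proof -
      have "(g t - g t0) / of_real (t - t0) - D = (g t - g t0 - (t - t0) *\<^sub>R D) / of_real (t - t0)"
        using that by (simp add: diff_divide_distrib scaleR_conv_of_real del: of_real_diff)
      then show ?thesis by (simp only: norm_divide norm_of_real real_norm_def)
    qed
    then show "\<forall>\<^sub>F t in at t0. norm (g t - g t0 - (t - t0) *\<^sub>R D) / norm (t - t0) =
        norm ((g t - g t0) / of_real (t - t0) - D)"
      by (auto simp: eventually_at_filter)
  qed
  then show ?thesis using Lim_null tendsto_norm_zero_iff by blast
qed

text \<open>The angular derivative, rewritten as a difference quotient over chords of the circle.\<close>

lemma circle_quotient_tendsto:
  assumes D: "((\<lambda>t. F (cis t)) has_vector_derivative D) (at t0)"
  shows "((\<lambda>w. (F w - F (cis t0)) / (w - cis t0)) \<longlongrightarrow> D / (\<i> * cis t0)) (at (cis t0) within sphere 0 1)"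
proof -
  define \<zeta> where "\<zeta> = cis t0"
  have \<zeta>: "norm \<zeta> = 1" "\<zeta> \<noteq> 0" by (simp_all add: \<zeta>_def)
  have "(cis has_vector_derivative (\<i> * \<zeta>)) (at t0)"
  proof -
    have "((\<lambda>z. exp (\<i> * z)) has_field_derivative (\<i> * exp (\<i> * of_real t0))) (at (of_real t0))"
      by (auto intro!: derivative_eq_intros)
    from has_vector_derivative_real_field[OF this] show ?thesis
      by (simp add: cis_conv_exp[symmetric] \<zeta>_def)
  qed
  from vector_derivative_quotient_tendsto[OF this]
  have c: "((\<lambda>t. (cis t - \<zeta>) / of_real (t - t0)) \<longlongrightarrow> \<i> * \<zeta>) (at t0)" by (simp add: \<zeta>_def)
  have "((\<lambda>t. ((F (cis t) - F \<zeta>) / of_real (t - t0)) / ((cis t - \<zeta>) / of_real (t - t0)))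
      \<longlongrightarrow> D / (\<i> * \<zeta>)) (at t0)"
    using vector_derivative_quotient_tendsto[OF D] c \<zeta> by (intro tendsto_divide) (auto simp: \<zeta>_def)
  then have lim: "((\<lambda>t. (F (cis t) - F \<zeta>) / (cis t - \<zeta>)) \<longlongrightarrow> D / (\<i> * \<zeta>)) (at t0)"
    by (rule Lim_transform_eventually) (auto simp: eventually_at_filter)
  \<comment> \<open>The angle of \<open>w\<close> near \<open>t0\<close>, continuous at \<open>\<zeta>\<close> because the branch cut of \<open>Arg\<close> is rotated away.\<close>
  define \<tau> where "\<tau> w = t0 + Arg (w / \<zeta>)" for w
  have cis_\<tau>: "cis (\<tau> w) = w" if "w \<in> sphere 0 1" for w
  proof -
    have "cis (Arg (w / \<zeta>)) = w / \<zeta>"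
      using that \<zeta> by (subst cis_Arg) (auto simp: sgn_div_norm norm_divide)
    then show ?thesis using \<zeta>(2) by (simp add: \<tau>_def cis_mult[symmetric] \<zeta>_def[symmetric])
  qed
  have "isCont Arg 1" by (intro continuous_at_Arg) (simp add: complex_nonpos_Reals_iff)
  moreover have "((\<lambda>w. w / \<zeta>) \<longlongrightarrow> 1) (at \<zeta> within sphere 0 1)"
    using tendsto_divide[OF tendsto_ident_at tendsto_const[of \<zeta>], of \<zeta> "sphere 0 1"] \<zeta>(2) by simp
  ultimately have "((\<lambda>w. Arg (w / \<zeta>)) \<longlongrightarrow> Arg 1) (at \<zeta> within sphere 0 1)"
    by (rule isCont_tendsto_compose)
  then have "(\<tau> \<longlongrightarrow> t0 + Arg 1) (at \<zeta> within sphere 0 1)"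
    unfolding \<tau>_def by (intro tendsto_add tendsto_const)
  then have \<tau>_lim: "(\<tau> \<longlongrightarrow> t0) (at \<zeta> within sphere 0 1)"
    by (simp add: Arg_eq_0[THEN iffD2])
  have "filterlim \<tau> (at t0) (at \<zeta> within sphere 0 1)"
    using \<tau>_lim unfolding filterlim_at
  proof (intro conjI)
    show "\<forall>\<^sub>F w in at \<zeta> within sphere 0 1. \<tau> w \<in> UNIV \<and> \<tau> w \<noteq> t0"
      unfolding eventually_at_filter
      by (intro always_eventually allI impI conjI UNIV_I) (metis cis_\<tau> \<zeta>_def)
  qed
  from filterlim_compose[OF lim this]
  show ?thesis
    unfolding \<zeta>_def[symmetric]
    by (rule Lim_transform_eventually) (auto simp: eventually_at_filter cis_\<tau>)
qed

text \<open>For \<open>z\<close> in a Stolz region, \<open>G\<close> is small compared with \<open>1 - \<bar>z\<bar>\<close> on the disc about \<open>z\<close> of half that radius.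
  Cauchy's estimate converts this into smallness of the derivative.\<close>

lemma nontangential_limit_of_derivative:
  assumes der: "\<And>z. z \<in> ball 0 1 \<Longrightarrow> (G has_field_derivative g z) (at z)"
    and \<zeta>: "norm \<zeta> = 1"
    and lim: "((\<lambda>z. G z / (z - \<zeta>)) \<longlongrightarrow> 0) (at \<zeta> within ball 0 1)"
  shows "has_nontangential_limit g 0 \<zeta>"
  unfolding has_nontangential_limit_def
proof (intro allI impI)
  fix \<alpha> :: real assume \<alpha>: "\<alpha> > 1"
  have hol: "G holomorphic_on ball 0 1"
    unfolding holomorphic_on_open[OF open_ball] using der by blast
  show "(g \<longlongrightarrow> 0) (at \<zeta> within stolz_region \<alpha> \<zeta>)"
    unfolding tendsto_iff
  proof (intro allI impI)
    fix e :: real assume "e > 0"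
    define e' where "e' = e / (4 * \<alpha>)"
    have e': "e' > 0" "3 * \<alpha> * e' < e" using \<open>e > 0\<close> \<alpha> by (auto simp: e'_def)
    obtain d where d: "d > 0" "\<And>z. z \<in> ball 0 1 \<Longrightarrow> z \<noteq> \<zeta> \<Longrightarrow> dist z \<zeta> < d \<Longrightarrow> norm (G z / (z - \<zeta>)) < e'"
      using tendstoD[OF lim e'(1)] unfolding eventually_at by auto
    have "norm (g z) < e" if z: "z \<in> stolz_region \<alpha> \<zeta>" "dist z \<zeta> < d / 2" for z
    proof -
      define \<rho> where "\<rho> = (1 - norm z) / 2"
      have nz: "norm z < 1" and st: "norm (\<zeta> - z) < \<alpha> * (1 - norm z)"
        using z(1) by (auto simp: stolz_region_def)
      have \<rho>: "\<rho> > 0" using nz by (simp add: \<rho>_def)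
      have "1 - norm z \<le> norm (\<zeta> - z)" using norm_triangle_ineq2[of \<zeta> z] \<zeta> by simp
      then have \<rho>_le: "2 * \<rho> \<le> norm (\<zeta> - z)" by (simp add: \<rho>_def)
      have sub: "cball z \<rho> \<subseteq> ball 0 1"
      proof
        fix w assume "w \<in> cball z \<rho>"
        then have "norm w \<le> norm z + \<rho>"
          using norm_triangle_ineq[of z "w - z"] by (simp add: dist_norm norm_minus_commute)
        then show "w \<in> ball 0 1" using nz by (simp add: \<rho>_def field_simps)
      qed
      have "norm ((deriv ^^ 1) G z) \<le> fact 1 * (3 * \<alpha> * e' * \<rho>) / \<rho> ^ 1"
      proof (rule Cauchy_inequality)
        show "G holomorphic_on ball z \<rho>" using sub by (intro holomorphic_on_subset[OF hol]) auto
        show "continuous_on (cball z \<rho>) G"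
          using sub by (intro holomorphic_on_imp_continuous_on holomorphic_on_subset[OF hol])
        fix w assume w: "norm (z - w) = \<rho>"
        have wb: "w \<in> ball 0 1" using sub w by (auto simp: dist_norm)
        have "norm (\<zeta> - w) \<le> norm (\<zeta> - z) + norm (z - w)"
          using norm_triangle_ineq[of "\<zeta> - z" "z - w"] by simp
        then have wz: "norm (\<zeta> - w) \<le> 3 / 2 * norm (\<zeta> - z)" using \<rho>_le w by simp
        then have "dist w \<zeta> < d" using z(2) d(1) by (simp add: dist_norm norm_minus_commute)
        moreover have "w \<noteq> \<zeta>" using wb \<zeta> by auto
        ultimately have "norm (G w) / norm (\<zeta> - w) < e'"
          using d(2)[OF wb] by (simp add: norm_divide norm_minus_commute)
        then have "norm (G w) \<le> e' * norm (\<zeta> - w)"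
          using \<open>w \<noteq> \<zeta>\<close> by (simp add: field_simps)
        also have "\<dots> \<le> e' * (3 / 2 * norm (\<zeta> - z))" using wz e' by (intro mult_left_mono) auto
        also have "\<dots> \<le> e' * (3 / 2 * (\<alpha> * (1 - norm z)))" using st e' by (intro mult_left_mono) auto
        also have "\<dots> = 3 * \<alpha> * e' * \<rho>" by (simp add: \<rho>_def)
        finally show "norm (G w) \<le> 3 * \<alpha> * e' * \<rho>" .
      qed (rule \<rho>)
      moreover have "deriv G z = g z" using der nz by (intro DERIV_imp_deriv) auto
      ultimately show ?thesis using e'(2) \<rho> by simp
    qed
    then show "\<forall>\<^sub>F z in at \<zeta> within stolz_region \<alpha> \<zeta>. dist (g z) 0 < e"
      unfolding eventually_at using d(1) by (intro exI[of _ "d / 2"]) auto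
  qed
qed

lemma has_nontangential_limit_add_const:
  "has_nontangential_limit (\<lambda>z. f z - c) 0 \<zeta> \<Longrightarrow> has_nontangential_limit f c \<zeta>"
  unfolding has_nontangential_limit_def by (metis Lim_null)

text \<open>Subtracting from \<open>F\<close> its linear approximation at \<open>\<zeta>\<close> gives a function \<open>G\<close> whose quotient by \<open>z - \<zeta>\<close>
  is bounded by the Lipschitz condition and tends to 0 along the circle, hence also from inside the disc.\<close>

lemma nontangential_limit_of_tangential_derivative:
  assumes lip: "K-lipschitz_on (cball 0 1) F"
    and der: "\<And>z. z \<in> ball 0 1 \<Longrightarrow> (F has_field_derivative f z) (at z)"
    and diff: "(\<lambda>t. F (cis t)) differentiable (at t0)"
  shows "\<exists>w. has_nontangential_limit f w (cis t0)"
proof -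
  define \<zeta> where "\<zeta> = cis t0"
  have \<zeta>: "norm \<zeta> = 1" by (simp add: \<zeta>_def)
  obtain D where D: "((\<lambda>t. F (cis t)) has_vector_derivative D) (at t0)"
    using diff vector_derivative_works by blast
  define c where "c = D / (\<i> * \<zeta>)"
  define G where "G z = F z - F \<zeta> - c * (z - \<zeta>)" for z
  define q where "q w = G w / (w - \<zeta>)" for w
  have hol: "F holomorphic_on ball 0 1" unfolding holomorphic_on_open[OF open_ball] using der by blast
  have "(q \<longlongrightarrow> 0) (at \<zeta> within ball 0 1)"
  proof (rule limit_in_disc_of_limit_on_circle)
    show "q holomorphic_on ball 0 1"
      unfolding q_def[abs_def] G_def[abs_def]
      using \<zeta> by (intro holomorphic_intros hol) auto
    show "continuous_on (cball 0 1 - {\<zeta>}) q"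
      unfolding q_def[abs_def] G_def[abs_def]
      by (intro continuous_intros continuous_on_subset[OF lipschitz_on_continuous_on[OF lip]]) auto
    show "norm (q w) \<le> K + norm c" if w: "w \<in> cball 0 1" for w
    proof -
      have "norm (F w - F \<zeta>) \<le> K * norm (w - \<zeta>)"
        using lipschitz_onD[OF lip w, of \<zeta>] \<zeta> by (simp add: dist_norm)
      moreover have "norm (G w) \<le> norm (F w - F \<zeta>) + norm (c * (w - \<zeta>))"
        unfolding G_def by (rule norm_triangle_ineq4)
      ultimately have "norm (G w) \<le> (K + norm c) * norm (w - \<zeta>)"
        by (simp add: norm_mult distrib_right)
      moreover have "K \<ge> 0" using lip by (rule lipschitz_on_nonneg)
      ultimately show ?thesis
        by (cases "w = \<zeta>") (simp_all add: q_def norm_divide divide_le_eq)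
    qed
    show "(q \<longlongrightarrow> 0) (at \<zeta> within sphere 0 1)"
    proof (rule Lim_transform_eventually)
      show "((\<lambda>w. (F w - F \<zeta>) / (w - \<zeta>) - c) \<longlongrightarrow> 0) (at \<zeta> within sphere 0 1)"
        using circle_quotient_tendsto[OF D] by (subst Lim_null[symmetric]) (simp add: c_def \<zeta>_def)
      show "\<forall>\<^sub>F w in at \<zeta> within sphere 0 1. (F w - F \<zeta>) / (w - \<zeta>) - c = q w"
        by (auto simp: eventually_at_filter q_def G_def diff_divide_distrib)
    qed
  qed (use \<zeta> in \<open>auto simp: q_def\<close>)
  then have "has_nontangential_limit (\<lambda>z. f z - c) 0 \<zeta>"
    unfolding q_def
  proof (intro nontangential_limit_of_derivative[of G] \<zeta>)
    fix z :: complex assume "z \<in> ball 0 1"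
    from der[OF this] show "(G has_field_derivative f z - c) (at z)"
      unfolding G_def[abs_def] by (auto intro!: derivative_eq_intros)
  qed
  then show ?thesis unfolding \<zeta>_def by (blast intro: has_nontangential_limit_add_const)
qed

lemma AE_lborel_iff_negligible: "(AE t in lborel. P t) \<longleftrightarrow> negligible {t::real. \<not> P t}"
proof
  assume "AE t in lborel. P t"
  then obtain N where "N \<in> null_sets lborel" "{t. \<not> P t} \<subseteq> N"
    by (auto simp: eventually_ae_filter)
  then show "negligible {t. \<not> P t}"
    by (meson negligible_iff_null_sets negligible_subset null_sets_completionI)
next
  assume "negligible {t. \<not> P t}"
  then have "{t. \<not> P t} \<in> null_sets lebesgue" by (simp add: negligible_iff_null_sets)
  from AE_not_in[OF this] show "AE t in lborel. P t" by (simp add: AE_completion_iff)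
qed

lemma AE_circle:
  assumes "negligible {t \<in> {0<..<2 * pi}. \<not> Q (cis t)}"
  shows "AE t in lborel. Q (cis t)"
proof -
  \<comment> \<open>The point 0 accounts for the multiples of \<open>2 \<pi>\<close>, which the open interval misses.\<close>
  define S where "S = insert 0 {t \<in> {0<..<2 * pi}. \<not> Q (cis t)}"
  have "negligible S" unfolding S_def using assms by (simp only: negligible_insert)
  then have "negligible (\<Union>k::int. (+) (2 * pi * of_int k) ` S)"
    by (intro negligible_countable_Union negligible_translation) (auto intro: negligible_translation)
  moreover have "{t. \<not> Q (cis t)} \<subseteq> (\<Union>k::int. (+) (2 * pi * of_int k) ` S)"
  proof
    fix t assume t: "t \<in> {t. \<not> Q (cis t)}"
    define k where "k = \<lfloor>t / (2 * pi)\<rfloor>"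
    define s where "s = t - 2 * pi * of_int k"
    have "of_int k \<le> t / (2 * pi)" "t / (2 * pi) < of_int k + 1" unfolding k_def by linarith+
    then have s: "0 \<le> s" "s < 2 * pi" by (simp_all add: s_def field_simps)
    have "cis t = cis s" unfolding s_def by (simp add: cis_divide[symmetric] cis_multiple_2pi)
    then have "s \<in> S" using s t by (auto simp: S_def)
    then show "t \<in> (\<Union>k::int. (+) (2 * pi * of_int k) ` S)"
      by (intro UN_I[of k] image_eqI[of _ _ s]) (auto simp: s_def)
  qed
  ultimately show ?thesis unfolding AE_lborel_iff_negligible by (rule negligible_subset)
qed

lemma power_zero_sums: "(\<lambda>n. 0 ^ n * z ^ n) sums (1 :: complex)"
  using sums_finite[of "{0}" "\<lambda>n. 0 ^ n * z ^ n"] by (simp add: power_0_left)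

lemma H_infinity_square_summable:
  assumes "\<phi> \<in> H_infinity"
  shows "summable (\<lambda>n. (norm (taylor_coeff \<phi> n))\<^sup>2)"
proof -
  obtain K where K: "K > 0" "\<And>z. z \<in> ball 0 1 \<Longrightarrow> norm (\<phi> z) \<le> K"
    using assms unfolding H_infinity_def bounded_pos by auto
  have one: "taylor_coeff (\<lambda>z. 1) n = 0 ^ n" for n
    by (rule taylor_coeff_unique) (rule power_zero_sums)
  have s: "summable (\<lambda>n. (norm (taylor_coeff (\<lambda>z. 1) n))\<^sup>2)"
    unfolding one by (rule summable_finite[of "{0}"]) auto
  from mult_coeff_bound[OF _ s _ K(2)] assms
  have "(\<Sum>n<N. (norm (taylor_coeff \<phi> n))\<^sup>2) \<le> K\<^sup>2 * (\<Sum>n. (norm (taylor_coeff (\<lambda>z. 1) n))\<^sup>2)" for N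
    by (simp add: H_infinity_def)
  then show ?thesis by (intro summableI_nonneg_bounded) auto
qed

lemma square_summable_tail_small:
  fixes a :: "nat \<Rightarrow> complex"
  assumes "summable (\<lambda>n. (norm (a n))\<^sup>2)" "e > 0"
  obtains N where "(\<Sum>n. (norm (if n < N then 0 else a n))\<^sup>2) \<le> e"
    "summable (\<lambda>n. (norm (if n < N then 0 else a n))\<^sup>2)"
proof -
  have s: "summable (\<lambda>n. (norm (if n < N then 0 else a n))\<^sup>2)" for N
    by (rule summable_comparison_test'[OF assms(1)]) auto
  obtain N where N: "norm (\<Sum>i. (norm (a (i + N)))\<^sup>2) < e"
    using suminf_exist_split[OF assms(2,1)] by blast
  have "(\<Sum>n. (norm (if n < N then 0 else a n))\<^sup>2) = (\<Sum>i. (norm (a (i + N)))\<^sup>2)"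
    using suminf_split_initial_segment[OF s, of N N] by simp
  with N have "(\<Sum>n. (norm (if n < N then 0 else a n))\<^sup>2) \<le> e" by simp
  then show ?thesis using s that by blast
qed

text \<open>Fatou's theorem. The boundary function of a primitive of \<open>f\<close> is approximated in variation by the primitives of
  the Taylor polynomials of \<open>f\<close>, and each of its points of differentiability gives a nontangential limit.\<close>

theorem bounded_holomorphic_nontangential_limits:
  assumes "f \<in> H_infinity"
  shows "AE t in lborel. \<exists>w. has_nontangential_limit f w (cis t)"
proof (rule AE_circle)
  have hol: "f holomorphic_on ball 0 1" using assms by (simp add: H_infinity_def)
  obtain K where K: "K > 0" "\<And>z. z \<in> ball 0 1 \<Longrightarrow> norm (f z) \<le> K"
    using assms unfolding H_infinity_def bounded_pos by auto
  obtain F0 where F0: "\<And>z. z \<in> ball 0 1 \<Longrightarrow> (F0 has_field_derivative f z) (at z within ball 0 1)"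
    using holomorphic_convex_primitive'[OF convex_ball open_ball hol] by blast
  have "K-lipschitz_on (ball 0 1) F0"
    using field_differentiable_bound[OF convex_ball F0 K(2)] K(1)
    by (intro lipschitz_onI) (auto simp: dist_norm)
  from lipschitz_extend_closure[OF this] obtain F where
    lip: "K-lipschitz_on (cball 0 1) F" and F: "\<And>z. z \<in> ball 0 1 \<Longrightarrow> F z = F0 z"
    by auto
  have der: "(F has_field_derivative f z) (at z)" if z: "z \<in> ball 0 1" for z
  proof -
    have "(F0 has_field_derivative f z) (at z)"
      using F0[OF z] z by (simp add: at_within_open[OF _ open_ball])
    then show ?thesis
      by (rule has_field_derivative_transform_within_open[OF _ open_ball z]) (simp add: F)
  qed
  define a where "a = taylor_coeff f"
  have "negligible {t \<in> {0<..<2 * pi}. \<not> (\<lambda>t. F (cis t)) differentiable (at t)}"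
  proof (rule differentiable_ae_of_variation_limit)
    fix e :: real assume e: "e > 0"
    define s where "s = e / (2 * pi)"
    have s: "s > 0" "2 * pi * s = e" using e by (simp_all add: s_def)
    obtain N where N: "(\<Sum>n. (norm (if n < N then 0 else a n))\<^sup>2) \<le> s\<^sup>2"
      "summable (\<lambda>n. (norm (if n < N then 0 else a n))\<^sup>2)"
      using square_summable_tail_small[OF H_infinity_square_summable[OF assms], of "s\<^sup>2"] s(1)
      unfolding a_def by auto
    define P where "P z = (\<Sum>n<N. a n * z ^ Suc n / of_nat (Suc n))" for z
    define p where "p z = (\<Sum>n<N. a n * z ^ n)" for z
    have P: "(P has_field_derivative p z) (at z)" for z
      unfolding P_def[abs_def] p_def
      by (auto intro!: derivative_eq_intros sum.cong simp del: of_nat_Suc power_Suc)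
    have hol': "(\<lambda>z. f z - p z) holomorphic_on ball 0 1"
      unfolding p_def by (intro holomorphic_intros hol)
    have coeff: "taylor_coeff (\<lambda>z. f z - p z) n = (if n < N then 0 else a n)" for n
    proof (rule taylor_coeff_unique)
      fix z :: complex assume z: "z \<in> ball 0 1"
      have "(\<lambda>n. if n \<in> {..<N} then a n * z ^ n else 0) sums p z"
        unfolding p_def by (rule sums_If_finite_set) simp
      from sums_diff[OF taylor_coeff_sums[OF hol z] this]
      show "(\<lambda>n. (if n < N then 0 else a n) * z ^ n) sums (f z - p z)"
        by (rule sums_cong[THEN iffD1, rotated]) (auto simp: a_def)
    qed
    have "variation_at_most (\<lambda>t. F (cis t) - P (cis t)) 0 (2 * pi) e"
      unfolding s(2)[symmetric]
    proof (rule primitive_boundary_variation[where h = "\<lambda>z. f z - p z"])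
      show "continuous_on (cball 0 1) (\<lambda>z. F z - P z)"
        unfolding P_def by (intro continuous_intros lipschitz_on_continuous_on[OF lip]) (auto simp del: of_nat_Suc)
    qed (use hol' coeff N s in \<open>auto intro!: derivative_intros der P\<close>)
    moreover have "(\<lambda>t. P (cis t)) differentiable (at t)" for t
    proof -
      have "((\<lambda>z. P (exp (\<i> * z))) has_field_derivative p (exp (\<i> * of_real t)) * (\<i> * exp (\<i> * of_real t))) (at (of_real t))"
        by (rule DERIV_chain2[OF P]) (auto intro!: derivative_eq_intros)
      from has_vector_derivative_real_field[OF this] show ?thesis
        by (intro differentiableI_vector) (simp add: cis_conv_exp)
    qed
    ultimately show "\<exists>P. (\<forall>t. P differentiable (at t)) \<and>
        variation_at_most (\<lambda>t. F (cis t) - P t) 0 (2 * pi) e"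
      by blast
  qed
  then show "negligible {t \<in> {0<..<2 * pi}. \<not> (\<exists>w. has_nontangential_limit f w (cis t))}"
    by (rule negligible_subset) (use nontangential_limit_of_tangential_derivative[OF lip der] in blast)
qed

section \<open>Inner functions and isometric multiplication\<close>

lemma radial_limit_of_nontangential:
  assumes "has_nontangential_limit f w (cis t)"
  shows "(\<lambda>n. f (of_real (radius n) * cis t)) \<longlonglongrightarrow> w"
proof -
  let ?Z = "\<lambda>n. of_real (radius n) * cis t"
  have lim: "(f \<longlongrightarrow> w) (at (cis t) within stolz_region 2 (cis t))"
    using assms unfolding has_nontangential_limit_def by auto
  have Z: "?Z n \<in> stolz_region 2 (cis t) - {cis t}" for n
  proof -
    have "cis t - ?Z n = of_real (1 - radius n) * cis t" by (simp add: algebra_simps)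
    then have "norm (cis t - ?Z n) = 1 - radius n"
      using radius_bounds[of n] by (simp only: norm_mult norm_of_real norm_cis) simp
    then show ?thesis
      using radius_bounds[of n] by (auto simp: stolz_region_def norm_mult)
  qed
  have "?Z \<longlonglongrightarrow> of_real 1 * cis t" by (intro tendsto_intros radius_tendsto)
  with Z lim show ?thesis unfolding tendsto_at_iff_sequentially o_def by auto
qed

text \<open>Both sides of Parseval's identity on the circle of radius \<open>r\<close> converge as \<open>r\<close> tends to 1: the integrals are
  dominated by the supremum of \<open>\<bar>g\<bar>\<^sup>2\<close>, the series by its value at radius 1.\<close>

lemma boundary_parseval:
  assumes g: "g \<in> H_infinity" and X: "negligible X"
    and lim: "\<And>t. t \<in> {0..2 * pi} - X \<Longrightarrow> (\<lambda>n. (norm (g (of_real (radius n) * cis t)))\<^sup>2) \<longlonglongrightarrow> L t"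
  shows "(L has_integral 2 * pi * (\<Sum>n. (norm (taylor_coeff g n))\<^sup>2)) {0..2 * pi}"
proof -
  have hol: "g holomorphic_on ball 0 1" using g by (simp add: H_infinity_def)
  obtain K where K: "K > 0" "\<And>z. z \<in> ball 0 1 \<Longrightarrow> norm (g z) \<le> K"
    using g unfolding H_infinity_def bounded_pos by auto
  define S where "S = {0..2 * pi} - X"
  define c where "c n = (norm (taylor_coeff g n))\<^sup>2" for n
  have c: "summable c" unfolding c_def by (rule H_infinity_square_summable[OF g])
  have SX: "(f has_integral y) S \<longleftrightarrow> (f has_integral y) {0..2 * pi}" for f :: "real \<Rightarrow> real" and y
    by (intro has_integral_spike_set_eq negligible_subset[OF X]) (auto simp: S_def)
  define F where "F k t = (norm (g (of_real (radius k) * cis t)))\<^sup>2" for k t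
  define y where "y k = 2 * pi * (\<Sum>n. c n * radius k ^ (2 * n))" for k
  have F_int: "(F k has_integral y k) {0..2 * pi}" for k
    using parseval[OF hol radius_bounds, of k] unfolding F_def[abs_def] y_def c_def
    by (auto simp: sums_iff has_integral_iff)
  have K_int: "(\<lambda>x. K\<^sup>2) integrable_on S"
    using integrable_const_ivl[of "K\<^sup>2" 0 "2 * pi"] unfolding integrable_on_def SX .
  have F_le: "norm (F k t) \<le> K\<^sup>2" for k t
    using radius_bounds[of k] by (auto simp: F_def norm_mult intro!: power_mono K(2))
  have y_lim: "y \<longlonglongrightarrow> 2 * pi * (\<Sum>n. c n)"
  proof -
    have "(\<lambda>k. \<Sum>n. c n * radius k ^ (2 * n)) \<longlonglongrightarrow> (\<Sum>n. c n * 1 ^ (2 * n))"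
    proof (rule tannerys_theorem[THEN conjunct2, THEN conjunct2])
      show "(\<lambda>k. c n * radius k ^ (2 * n)) \<longlonglongrightarrow> c n * 1 ^ (2 * n)" for n
        by (intro tendsto_intros radius_tendsto)
      have "norm (c n * radius k ^ (2 * n)) \<le> c n" for n k
        using radius_bounds[of k] by (auto simp: c_def abs_mult intro!: mult_left_le power_le_one)
      then show "\<forall>\<^sub>F (n, k) in sequentially \<times>\<^sub>F sequentially. norm (c n * radius k ^ (2 * n)) \<le> c n"
        by (intro always_eventually) auto
    qed (use c in auto)
    then show ?thesis unfolding y_def[abs_def] by (intro tendsto_intros) simp
  qed
  have "(\<lambda>k. F k t) \<longlonglongrightarrow> L t" if "t \<in> S" for t
    using lim that by (simp add: F_def S_def)
  then have "(L has_integral 2 * pi * (\<Sum>n. c n)) S"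
    using F_int F_le
    by (intro has_integral_dominated_convergence[OF iffD2[OF SX] K_int _ _ y_lim]) blast+
  then show ?thesis by (simp add: SX c_def)
qed

lemma norm_h2_sq_H_infinity:
  assumes "\<And>z. z \<in> ball 0 1 \<Longrightarrow> h2_fun f z = g z" "g holomorphic_on ball 0 1"
  shows "(norm f)\<^sup>2 = (\<Sum>n. (norm (taylor_coeff g n))\<^sup>2)"
  unfolding norm_h2_sq h2_coeff_def using taylor_coeff_cong[OF assms(2,1)] by simp

text \<open>For a polynomial \<open>p\<close>, both \<open>p\<close> and \<open>\<theta> p\<close> have radial limits of modulus \<open>\<bar>p\<bar>\<close> almost everywhere, so their norms agree.
  Polynomials are dense.\<close>

lemma mult_op_inner_isometry:
  assumes "inner_function \<theta>"
  shows "norm (mult_op \<theta> f) = norm f"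
proof -
  have \<theta>: "\<theta> \<in> H_infinity" using assms by (simp add: inner_function_def)
  define X where "X = {t. \<not> (\<exists>w. has_nontangential_limit \<theta> w (cis t) \<and> norm w = 1)}"
  have X: "negligible X"
    using assms unfolding inner_function_def AE_lborel_iff_negligible X_def by blast
  have trunc: "norm (mult_op \<theta> (h2_trunc N f)) = norm (h2_trunc N f)" for N
  proof -
    define p where "p z = (\<Sum>n<N. h2_coeff f n * z ^ n)" for z
    have p_cont: "continuous_on A p" for A unfolding p_def by (intro continuous_intros)
    have p_hol: "p holomorphic_on A" for A unfolding p_def by (intro holomorphic_intros)
    have "bounded (p ` cball 0 1)"
      by (intro compact_imp_bounded compact_continuous_image p_cont) simp
    then have "bounded (p ` ball 0 1)" by (rule bounded_subset) auto
    then have p: "p \<in> H_infinity" using p_hol by (simp add: H_infinity_def)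
    obtain A where A: "A > 0" "\<And>z. z \<in> ball 0 1 \<Longrightarrow> norm (\<theta> z) \<le> A"
      using \<theta> unfolding H_infinity_def bounded_pos by auto
    obtain B where B: "B > 0" "\<And>z. z \<in> ball 0 1 \<Longrightarrow> norm (p z) \<le> B"
      using p unfolding H_infinity_def bounded_pos by auto
    have "norm (\<theta> z * p z) \<le> A * B" if "z \<in> ball 0 1" for z
      unfolding norm_mult using A B that by (intro mult_mono) auto
    then have "bounded ((\<lambda>z. \<theta> z * p z) ` ball 0 1)"
      unfolding bounded_iff by blast
    then have \<theta>p: "(\<lambda>z. \<theta> z * p z) \<in> H_infinity"
      using \<theta> p by (auto simp: H_infinity_def intro!: holomorphic_intros)
    have p_lim: "(\<lambda>n. p (of_real (radius n) * cis t)) \<longlonglongrightarrow> p (cis t)" for t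
      by (rule radial_tendsto[OF p_cont]) simp
    have "((\<lambda>t. (norm (p (cis t)))\<^sup>2) has_integral 2 * pi * (\<Sum>n. (norm (taylor_coeff p n))\<^sup>2)) {0..2 * pi}"
      by (rule boundary_parseval[OF p negligible_empty]) (intro tendsto_intros p_lim)
    moreover have "((\<lambda>t. (norm (p (cis t)))\<^sup>2) has_integral
        2 * pi * (\<Sum>n. (norm (taylor_coeff (\<lambda>z. \<theta> z * p z) n))\<^sup>2)) {0..2 * pi}"
    proof (rule boundary_parseval[OF \<theta>p X])
      fix t assume "t \<in> {0..2 * pi} - X"
      then obtain w where w: "has_nontangential_limit \<theta> w (cis t)" "norm w = 1" by (auto simp: X_def)
      have "(\<lambda>n. (norm (\<theta> (of_real (radius n) * cis t) * p (of_real (radius n) * cis t)))\<^sup>2)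
          \<longlonglongrightarrow> (norm (w * p (cis t)))\<^sup>2"
        by (intro tendsto_intros p_lim radial_limit_of_nontangential w)
      then show "(\<lambda>n. (norm (\<theta> (of_real (radius n) * cis t) * p (of_real (radius n) * cis t)))\<^sup>2)
          \<longlonglongrightarrow> (norm (p (cis t)))\<^sup>2"
        using w(2) by (simp add: norm_mult)
    qed
    ultimately have "2 * pi * (\<Sum>n. (norm (taylor_coeff p n))\<^sup>2) =
        2 * pi * (\<Sum>n. (norm (taylor_coeff (\<lambda>z. \<theta> z * p z) n))\<^sup>2)"
      by (rule has_integral_unique)
    then have "(\<Sum>n. (norm (taylor_coeff (\<lambda>z. \<theta> z * p z) n))\<^sup>2) = (\<Sum>n. (norm (taylor_coeff p n))\<^sup>2)"
      by simp
    moreover have "(norm (mult_op \<theta> (h2_trunc N f)))\<^sup>2 = (\<Sum>n. (norm (taylor_coeff (\<lambda>z. \<theta> z * p z) n))\<^sup>2)"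
      using \<theta>p by (intro norm_h2_sq_H_infinity) (auto simp: mult_op_apply[OF \<theta>] h2_fun_trunc p_def H_infinity_def)
    moreover have "(norm (h2_trunc N f))\<^sup>2 = (\<Sum>n. (norm (taylor_coeff p n))\<^sup>2)"
      by (intro norm_h2_sq_H_infinity p_hol) (simp add: h2_fun_trunc p_def)
    ultimately have "(norm (mult_op \<theta> (h2_trunc N f)))\<^sup>2 = (norm (h2_trunc N f))\<^sup>2" by simp
    then show ?thesis by (simp add: power2_eq_iff_nonneg)
  qed
  have "(\<lambda>N. norm (mult_op \<theta> (h2_trunc N f))) \<longlonglongrightarrow> norm (mult_op \<theta> f)"
    by (intro tendsto_intros h2_trunc_tendsto)
  moreover have "(\<lambda>N. norm (mult_op \<theta> (h2_trunc N f))) \<longlonglongrightarrow> norm f"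
    unfolding trunc by (intro tendsto_norm h2_trunc_tendsto)
  ultimately show ?thesis by (rule LIMSEQ_unique)
qed

text \<open>The kernel \<open>k\<close> at \<open>z\<close> satisfies \<open>k z = \<parallel>k\<parallel>\<^sup>2\<close>, while the value of \<open>\<theta> k\<close> at \<open>z\<close> is at most
  \<open>\<parallel>\<theta> k\<parallel> \<parallel>k\<parallel> = \<parallel>k\<parallel>\<^sup>2\<close>.\<close>

lemma isometric_mult_op_norm_le_1:
  assumes \<theta>: "\<theta> \<in> H_infinity" and iso: "\<And>f. norm (mult_op \<theta> f) = norm f" and z: "z \<in> ball 0 1"
  shows "norm (\<theta> z) \<le> 1"
proof -
  define k where "k = h2_kernel z"
  have "norm (h2_coeff k 0) \<le> norm k" by (rule norm_h2_coeff_le)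
  then have k0: "norm k > 0" using z by (auto simp: k_def h2_coeff_kernel)
  have "(norm k)\<^sup>2 = Re (h2_fun k z)"
    using inner_h2_kernel[OF z, of k] by (simp add: k_def power2_norm_eq_inner)
  also have "\<dots> \<le> norm (h2_fun k z)" by (rule complex_Re_le_cmod)
  finally have "norm (\<theta> z) * (norm k)\<^sup>2 \<le> norm (\<theta> z) * norm (h2_fun k z)"
    by (intro mult_left_mono) auto
  also have "\<dots> = norm (h2_fun (mult_op \<theta> k) z)" using z by (simp add: mult_op_apply[OF \<theta>] norm_mult)
  also have "\<dots> \<le> norm (mult_op \<theta> k) * norm k" unfolding k_def by (rule norm_h2_fun_le[OF z])
  finally show ?thesis using k0 by (simp add: iso power2_eq_square)
qed

text \<open>Applying the isometry to the constant 1 shows that \<open>\<bar>\<theta>\<bar>\<^sup>2\<close> has boundary mean 1. Its boundary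
  values are at most 1, so they equal 1 almost everywhere.\<close>

lemma inner_function_of_isometry:
  assumes \<theta>: "\<theta> \<in> H_infinity" and iso: "\<And>f. norm (mult_op \<theta> f) = norm f"
  shows "inner_function \<theta>"
proof -
  have hol: "\<theta> holomorphic_on ball 0 1" using \<theta> by (simp add: H_infinity_def)
  define X where "X = {t. \<not> (\<exists>w. has_nontangential_limit \<theta> w (cis t))}"
  have X: "negligible X"
    using bounded_holomorphic_nontangential_limits[OF \<theta>] unfolding AE_lborel_iff_negligible X_def .
  define W where "W t = (SOME w. has_nontangential_limit \<theta> w (cis t))" for t
  have W: "has_nontangential_limit \<theta> (W t) (cis t)" if "t \<notin> X" for t
    unfolding W_def by (rule someI_ex) (use that in \<open>simp add: X_def\<close>)
  \<comment> \<open>The value 1 on the exceptional set keeps \<open>1 - L\<close> nonnegative everywhere.\<close>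
  define L where "L t = (if t \<in> X then 1 else (norm (W t))\<^sup>2)" for t
  have lim: "(\<lambda>n. (norm (\<theta> (of_real (radius n) * cis t)))\<^sup>2) \<longlonglongrightarrow> L t" if "t \<notin> X" for t
    using that by (auto simp: L_def intro!: tendsto_intros radial_limit_of_nontangential W)
  have r_le: "norm (\<theta> (of_real (radius n) * cis t)) \<le> 1" for n t
    using radius_bounds[of n] by (intro isometric_mult_op_norm_le_1[OF \<theta> iso]) (simp add: norm_mult)
  have le: "L t \<le> 1" for t
  proof (cases "t \<in> X")
    case False
    show ?thesis
      by (rule LIMSEQ_le_const2[OF lim[OF False]]) (use r_le in \<open>auto simp: power_le_one\<close>)
  qed (simp add: L_def)
  \<comment> \<open>The kernel at the origin is the constant function 1.\<close>
  define one where "one = h2_kernel 0"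
  have one_fun: "h2_fun one z = 1" if "z \<in> ball 0 1" for z
  proof -
    have "(\<lambda>n. 0 ^ n * z ^ n) sums h2_fun one z"
      using h2_fun_sums[OF that, of one] by (simp add: one_def h2_coeff_kernel)
    from sums_unique2[OF this power_zero_sums] show ?thesis .
  qed
  have "(norm one)\<^sup>2 = 1"
    using inner_h2_kernel[of 0 one] by (simp add: one_def[symmetric] power2_norm_eq_inner one_fun)
  then have "(\<Sum>n. (norm (taylor_coeff \<theta> n))\<^sup>2) = 1"
    using norm_h2_sq_H_infinity[OF _ hol, of "mult_op \<theta> one"]
    by (simp add: mult_op_apply[OF \<theta>] one_fun iso)
  with boundary_parseval[OF \<theta> X, of L] lim
  have L_int: "(L has_integral 2 * pi) {0..2 * pi}" by simp
  have "((\<lambda>t. 1 - L t) has_integral (2 * pi - 2 * pi)) {0..2 * pi}"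
    using has_integral_diff[OF has_integral_const_real[of "1::real" 0 "2 * pi"] L_int] by simp
  then have int0: "((\<lambda>t. 1 - L t) has_integral 0) {0..2 * pi}" by simp
  have "negligible {t \<in> {0..2 * pi}. 1 - L t \<noteq> 0}"
  proof -
    have ai: "(\<lambda>t. 1 - L t) absolutely_integrable_on {0..2 * pi}"
      using int0 le by (intro nonnegative_absolutely_integrable_1) auto
    then have "(LINT t:{0..2 * pi}|lebesgue. 1 - L t) = 0"
      using int0 by (simp add: set_lebesgue_integral_eq_integral(2) integral_unique)
    then have "AE t in lebesgue. indicator {0..2 * pi} t *\<^sub>R (1 - L t) = 0"
      using ai le unfolding set_lebesgue_integral_def set_integrable_def
      by (subst (asm) integral_nonneg_eq_0_iff_AE) auto
    then have "AE t in lborel. indicator {0..2 * pi} t *\<^sub>R (1 - L t) = 0"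
      by (simp add: AE_completion_iff)
    then show ?thesis
      unfolding AE_lborel_iff_negligible by (rule negligible_subset) auto
  qed
  then have N: "negligible (X \<union> {t \<in> {0..2 * pi}. 1 - L t \<noteq> 0})" using X by (rule negligible_Un[rotated])
  have "AE t in lborel. \<exists>w. has_nontangential_limit \<theta> w (cis t) \<and> norm w = 1"
  proof (rule AE_circle, rule negligible_subset[OF N], rule subsetI, rule ccontr)
    fix t assume t: "t \<in> {t \<in> {0<..<2 * pi}. \<not> (\<exists>w. has_nontangential_limit \<theta> w (cis t) \<and> norm w = 1)}"
      and "t \<notin> X \<union> {t \<in> {0..2 * pi}. 1 - L t \<noteq> 0}"
    then have "t \<notin> X" "L t = 1" by auto
    then have "has_nontangential_limit \<theta> (W t) (cis t)" "norm (W t) = 1"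
      using W by (auto simp: L_def power2_eq_1_iff)
        (smt (verit) norm_ge_zero)
    with t show False by blast
  qed
  with \<theta> show ?thesis by (simp add: inner_function_def)
qed


section \<open>Invariant subspaces of operators\<close>

lemma h2_subspace_closure:
  assumes "h2.subspace V"
  shows "h2.subspace (closure V)"
proof (rule h2.subspaceI)
  show "0 \<in> closure V" using h2.subspace_0[OF assms] closure_subset by blast
  fix x y assume "x \<in> closure V" "y \<in> closure V"
  then obtain u v where "\<And>n. u n \<in> V" "u \<longlonglongrightarrow> x" "\<And>n. v n \<in> V" "v \<longlonglongrightarrow> y"
    unfolding closure_sequential by blast
  then show "x + y \<in> closure V"
    using h2.subspace_add[OF assms] tendsto_add[of u x sequentially v y]
    unfolding closure_sequential by (intro exI[of _ "\<lambda>n. u n + v n"]) auto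
next
  fix c x assume "x \<in> closure V"
  then have "h2_scaleC c x \<in> closure (h2_scaleC c ` V)"
    using closure_bounded_linear_image_subset[OF bounded_linear_h2_scaleC] by blast
  also have "\<dots> \<subseteq> closure V"
    using h2.subspace_scale[OF assms] by (intro closure_mono) auto
  finally show "h2_scaleC c x \<in> closure V" .
qed

definition generated_range :: "(h2 \<Rightarrow>\<^sub>L h2) set \<Rightarrow> h2 set" where
  "generated_range M = closure (h2.span (\<Union>T\<in>M. range (blinfun_apply T)))"

lemma apply_mem_generated_range: "T \<in> M \<Longrightarrow> blinfun_apply T f \<in> generated_range M"
  unfolding generated_range_def by (intro subsetD[OF closure_subset] h2.span_base) auto

lemma subspace_generated_range: "h2.subspace (generated_range M)"
  unfolding generated_range_def by (intro h2_subspace_closure h2.subspace_span)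

lemma generated_range_minimal:
  assumes "closed W" "h2.subspace W" "\<And>T f. T \<in> M \<Longrightarrow> blinfun_apply T f \<in> W"
  shows "generated_range M \<subseteq> W"
  unfolding generated_range_def using assms by (intro closure_minimal h2.span_minimal) auto

lemma shift_in_L_H2: "shift \<in> L_H2"
  by (simp add: L_H2_def shift_scaleC)

lemma invariant_generated_range:
  assumes "closed_shift_invariant M"
  shows "invariant_subspace (generated_range M)"
  unfolding invariant_subspace_def
proof (intro conjI subspace_generated_range ballI)
  show cl: "closed (generated_range M)" by (simp add: generated_range_def)
  let ?W = "{f. shift f \<in> generated_range M}"
  have "generated_range M \<subseteq> ?W"
  proof (rule generated_range_minimal)
    show "closed ?W"
      using cl by (intro closed_vimage[unfolded vimage_def] continuous_intros)
    show "h2.subspace ?W"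
      using subspace_generated_range[of M] shift_scaleC
      by (auto simp: h2.subspace_def blinfun.add_right blinfun.zero_right)
    fix T f assume "T \<in> M"
    then have "shift o\<^sub>L T \<in> M" using assms by (simp add: closed_shift_invariant_def)
    from apply_mem_generated_range[OF this, of f] show "T f \<in> ?W" by simp
  qed
  then show "shift f \<in> generated_range M" if "f \<in> generated_range M" for f
    using that by blast
qed

lemma subspace_L_H2: "op.subspace L_H2"
  by (rule op.subspaceI)
    (auto simp: L_H2_def blinfun.zero_left blinfun.add_left op_scaleC.rep_eq
      h2.scale_right_distrib h2.scale_left_commute)

lemma L_H2_compose: "S \<in> L_H2 \<Longrightarrow> T \<in> L_H2 \<Longrightarrow> S o\<^sub>L T \<in> L_H2"
  by (simp add: L_H2_def)

lemma op_subspace_imp_subspace: "op.subspace M \<Longrightarrow> subspace M"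
proof -
  have "op_scaleC (of_real r) T = r *\<^sub>R T" for r T
    by (rule blinfun_eqI) (simp add: op_scaleC.rep_eq blinfun.scaleR_left scaleR_h2_def)
  then show "op.subspace M \<Longrightarrow> subspace M"
    unfolding subspace_def op.subspace_def by metis
qed

lemma compose_add_right: "A o\<^sub>L (S + T) = (A o\<^sub>L S) + (A o\<^sub>L T)"
  by (rule blinfun_eqI) (simp add: blinfun.add_left blinfun.add_right)

lemma compose_op_scaleC: "A \<in> L_H2 \<Longrightarrow> A o\<^sub>L op_scaleC c T = op_scaleC c (A o\<^sub>L T)"
  by (rule blinfun_eqI) (simp add: op_scaleC.rep_eq L_H2_def)

lemma bounded_linear_compose_left: "bounded_linear (\<lambda>T. A o\<^sub>L T)"
  by (rule bounded_bilinear.bounded_linear_right[OF bounded_bilinear_blinfun_compose])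

lemma mult_op_compose_shift:
  assumes "\<phi> \<in> H_infinity"
  shows "mult_op \<phi> o\<^sub>L (shift o\<^sub>L T) = shift o\<^sub>L (mult_op \<phi> o\<^sub>L T)"
  by (rule blinfun_eqI) (simp add: mult_op_shift[OF assms])

lemma norm_compose_isometry:
  fixes A :: "'b::real_normed_vector \<Rightarrow>\<^sub>L 'c::real_normed_vector" and T :: "'a::real_normed_vector \<Rightarrow>\<^sub>L 'b"
  assumes "\<And>f. norm (blinfun_apply A f) = norm f"
  shows "norm (A o\<^sub>L T) = norm T"
  by (simp add: norm_blinfun.rep_eq onorm_def assms)

lemma inj_isometry:
  assumes "\<And>f. norm (blinfun_apply A f) = norm f"
  shows "inj (blinfun_apply A)"
proof (rule injI)
  fix f g assume "A f = A g"
  then have "norm (A (f - g)) = 0" by (simp add: blinfun.diff_right)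
  then show "f = g" by (simp add: assms)
qed

text \<open>The factor is the inverse of the isometry applied after \<open>T\<close>, so it has the same norm bound as \<open>T\<close>.\<close>

lemma factor_through_isometry:
  assumes A: "A \<in> L_H2" and iso: "\<And>f. norm (blinfun_apply A f) = norm f"
    and T: "T \<in> L_H2" "range (blinfun_apply T) \<subseteq> range (blinfun_apply A)"
  obtains T' where "T' \<in> L_H2" "T = A o\<^sub>L T'"
proof -
  have "\<forall>f. \<exists>g. A g = T f" using T(2) by (metis imageE rangeI subsetD)
  then obtain G where G: "\<And>f. A (G f) = T f" by metis
  have eqI: "x = y" if "A x = A y" for x y using inj_isometry[OF iso] that by (simp add: inj_eq)
  have "bounded_linear G"
  proof (rule bounded_linear_intro)
    show "G (x + y) = G x + G y" for x y by (rule eqI) (simp add: G blinfun.add_right)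
    show "G (r *\<^sub>R x) = r *\<^sub>R G x" for r x by (rule eqI) (simp add: G blinfun.scaleR_right)
    show "norm (G x) \<le> norm x * norm T" for x
      using norm_blinfun[of T x] iso[of "G x"] by (simp add: G mult.commute)
  qed
  then have rep: "blinfun_apply (Blinfun G) = G" by (rule bounded_linear_Blinfun_apply)
  show ?thesis
  proof
    show "Blinfun G \<in> L_H2"
      unfolding L_H2_def mem_Collect_eq rep
    proof (intro allI)
      show "G (h2_scaleC c f) = h2_scaleC c (G f)" for c f
        by (rule eqI) (use A T(1) in \<open>simp add: G L_H2_def\<close>)
    qed
    show "T = A o\<^sub>L Blinfun G" by (rule blinfun_eqI) (simp add: rep G)
  qed
qed

lemma closed_shift_invariant_preimage:
  assumes \<theta>: "\<theta> \<in> H_infinity" and M: "closed_shift_invariant M"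
  shows "closed_shift_invariant {T \<in> L_H2. mult_op \<theta> o\<^sub>L T \<in> M}"
proof -
  have sub: "op.subspace M" and cl: "closed M" and inv: "\<And>T. T \<in> M \<Longrightarrow> shift o\<^sub>L T \<in> M"
    using M by (auto simp: closed_shift_invariant_def)
  let ?M' = "{T \<in> L_H2. mult_op \<theta> o\<^sub>L T \<in> M}"
  have "closed ((\<lambda>T. mult_op \<theta> o\<^sub>L T) -` M)"
    using cl by (intro closed_vimage linear_continuous_on bounded_linear_compose_left)
  then have "closed (L_H2 \<inter> (\<lambda>T. mult_op \<theta> o\<^sub>L T) -` M)" using closed_L_H2 by (rule closed_Int[rotated])
  moreover have "L_H2 \<inter> (\<lambda>T. mult_op \<theta> o\<^sub>L T) -` M = ?M'" by auto
  moreover have "op.subspace ?M'"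
  proof (rule op.subspaceI)
    have "mult_op \<theta> o\<^sub>L 0 = 0" by (rule blinfun_eqI) (simp add: blinfun.zero_left blinfun.zero_right)
    then show "0 \<in> ?M'" using op.subspace_0[OF sub] op.subspace_0[OF subspace_L_H2] by simp
  qed (auto simp: compose_add_right compose_op_scaleC[OF mult_op_in_L_H2[OF \<theta>]]
      op.subspace_add[OF sub] op.subspace_add[OF subspace_L_H2]
      op.subspace_scale[OF sub] op.subspace_scale[OF subspace_L_H2])
  moreover have "shift o\<^sub>L T \<in> ?M'" if "T \<in> ?M'" for T
    using that inv by (auto simp: mult_op_compose_shift[OF \<theta>] L_H2_compose shift_in_L_H2)
  ultimately show ?thesis unfolding closed_shift_invariant_def by auto
qed

text \<open>Composition with an isometry preserves the operator norm, and isometric images of complete spaces are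
  closed.\<close>

lemma closed_shift_invariant_image:
  assumes \<theta>: "inner_function \<theta>" and M': "closed_shift_invariant M'"
  shows "closed_shift_invariant ((\<lambda>T. mult_op \<theta> o\<^sub>L T) ` M')"
  unfolding closed_shift_invariant_def
proof (intro conjI ballI)
  have \<theta>H: "\<theta> \<in> H_infinity" using \<theta> by (simp add: inner_function_def)
  have A: "mult_op \<theta> \<in> L_H2" by (rule mult_op_in_L_H2[OF \<theta>H])
  have L: "M' \<subseteq> L_H2" and sub: "op.subspace M'" and cl: "closed M'"
    and inv: "\<And>T. T \<in> M' \<Longrightarrow> shift o\<^sub>L T \<in> M'"
    using M' by (auto simp: closed_shift_invariant_def)
  show "(\<lambda>T. mult_op \<theta> o\<^sub>L T) ` M' \<subseteq> L_H2" using L A by (auto intro: L_H2_compose)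
  show "closed ((\<lambda>T. mult_op \<theta> o\<^sub>L T) ` M')"
    by (rule closed_image_isometry[OF bounded_linear_compose_left _ cl op_subspace_imp_subspace[OF sub]])
      (intro norm_compose_isometry mult_op_inner_isometry \<theta>)
  show "op.subspace ((\<lambda>T. mult_op \<theta> o\<^sub>L T) ` M')"
  proof (rule op.subspaceI)
    have "mult_op \<theta> o\<^sub>L 0 = 0" by (rule blinfun_eqI) (simp add: blinfun.zero_left blinfun.zero_right)
    then show "0 \<in> (\<lambda>T. mult_op \<theta> o\<^sub>L T) ` M'" using op.subspace_0[OF sub] by (metis imageI)
  qed (auto simp flip: compose_add_right compose_op_scaleC[OF A]
      intro!: imageI op.subspace_add[OF sub] op.subspace_scale[OF sub])
  show "shift o\<^sub>L T \<in> (\<lambda>T. mult_op \<theta> o\<^sub>L T) ` M'" if "T \<in> (\<lambda>T. mult_op \<theta> o\<^sub>L T) ` M'" for T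
    using that inv by (auto simp flip: mult_op_compose_shift[OF \<theta>H])
qed

text \<open>Beurling's theorem is applied to the closed span of the ranges. The family \<open>M'\<close> is as large as possible, which
  makes it closed and invariant at once.\<close>

lemma invariant_operators_factor:
  assumes M: "closed_shift_invariant M" and ne: "M \<noteq> {0}"
  obtains \<theta> M' where "inner_function \<theta>" "closed_shift_invariant M'" "generated_range M' = UNIV"
    "M = (\<lambda>T. mult_op \<theta> o\<^sub>L T) ` M'"
proof -
  have L: "M \<subseteq> L_H2" and sub: "op.subspace M" using M by (auto simp: closed_shift_invariant_def)
  have "generated_range M \<noteq> {0}"
  proof
    assume "generated_range M = {0}"
    then have "T = 0" if "T \<in> M" for T
      using apply_mem_generated_range[OF that] by (intro blinfun_eqI) (auto simp: blinfun.zero_left)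
    with ne op.subspace_0[OF sub] show False by blast
  qed
  then obtain \<theta> where \<theta>: "\<theta> \<in> H_infinity" and iso: "\<And>f. norm (mult_op \<theta> f) = norm f"
    and N: "generated_range M = range (mult_op \<theta>)"
    using invariant_subspace_eq_range_mult_op[OF invariant_generated_range[OF M]] by blast
  have A: "mult_op \<theta> \<in> L_H2" by (rule mult_op_in_L_H2[OF \<theta>])
  define M' where "M' = {T \<in> L_H2. mult_op \<theta> o\<^sub>L T \<in> M}"
  have M_sub: "\<exists>T'\<in>M'. T = mult_op \<theta> o\<^sub>L T'" if T: "T \<in> M" for T
  proof -
    have "range (blinfun_apply T) \<subseteq> range (mult_op \<theta>)"
      using apply_mem_generated_range[OF T] unfolding N by blast
    then obtain T' where "T' \<in> L_H2" "T = mult_op \<theta> o\<^sub>L T'"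
      using factor_through_isometry[OF A iso] T L by blast
    with T show ?thesis unfolding M'_def by blast
  qed
  let ?W = "generated_range M'"
  have W: "h2.subspace ?W" "closed ?W" by (rule subspace_generated_range) (simp add: generated_range_def)
  have "generated_range M \<subseteq> mult_op \<theta> ` ?W"
  proof (rule generated_range_minimal)
    show "closed (mult_op \<theta> ` ?W)"
      by (rule closed_image_isometry[OF blinfun.bounded_linear_right iso W(2) h2_subspace_imp_subspace[OF W(1)]])
    show "h2.subspace (mult_op \<theta> ` ?W)"
    proof (rule h2.subspaceI)
      show "0 \<in> mult_op \<theta> ` ?W" using h2.subspace_0[OF W(1)] by (metis blinfun.zero_right imageI)
    qed (auto simp flip: blinfun.add_right mult_op_scaleC[OF \<theta>]
        intro!: imageI h2.subspace_add[OF W(1)] h2.subspace_scale[OF W(1)])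
    fix T f assume "T \<in> M"
    then obtain T' where "T' \<in> M'" "T = mult_op \<theta> o\<^sub>L T'" using M_sub by blast
    then show "T f \<in> mult_op \<theta> ` ?W" using apply_mem_generated_range[of T' M' f] by auto
  qed
  then have "range (mult_op \<theta>) \<subseteq> mult_op \<theta> ` ?W" by (simp add: N)
  then have "?W = UNIV" using inj_isometry[OF iso] by (auto simp: inj_image_subset_iff)
  moreover have "M = (\<lambda>T. mult_op \<theta> o\<^sub>L T) ` M'" using M_sub by (auto simp: M'_def)
  moreover have "closed_shift_invariant M'"
    unfolding M'_def by (rule closed_shift_invariant_preimage[OF \<theta> M])
  ultimately show ?thesis using that inner_function_of_isometry[OF \<theta> iso] by blast
qed

theorem theorem3p2:
  shows
    "(\<forall>M. closed_shift_invariant M \<and> M \<noteq> {0} \<longrightarrow>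
        (\<exists>\<theta> M'. inner_function \<theta> \<and> closed_shift_invariant M' \<and>
            generates_H2 (\<Union>T\<in>M'. range (blinfun_apply T)) \<and>
            M = {mult_op \<theta> o\<^sub>L T' | T'. T' \<in> M'})) \<and>
     (\<forall>M. M \<subseteq> L_H2 \<and>
        (\<exists>\<theta> M'. inner_function \<theta> \<and> closed_shift_invariant M' \<and>
            generates_H2 (\<Union>T\<in>M'. range (blinfun_apply T)) \<and>
            M = {mult_op \<theta> o\<^sub>L T' | T'. T' \<in> M'})
        \<longrightarrow> closed_shift_invariant M)"
proof -
  have image: "{mult_op \<theta> o\<^sub>L T' | T'. T' \<in> M'} = (\<lambda>T. mult_op \<theta> o\<^sub>L T) ` M'" for \<theta> M' by blast
  show ?thesis
    unfolding image generates_H2_def generated_range_def[symmetric]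
  proof (intro conjI allI impI)
    fix M assume "closed_shift_invariant M \<and> M \<noteq> {0}"
    then show "\<exists>\<theta> M'. inner_function \<theta> \<and> closed_shift_invariant M' \<and> generated_range M' = UNIV \<and>
        M = (\<lambda>T. mult_op \<theta> o\<^sub>L T) ` M'"
      using invariant_operators_factor by metis
  next
    fix M assume "M \<subseteq> L_H2 \<and> (\<exists>\<theta> M'. inner_function \<theta> \<and> closed_shift_invariant M' \<and>
        generated_range M' = UNIV \<and> M = (\<lambda>T. mult_op \<theta> o\<^sub>L T) ` M')"
    then show "closed_shift_invariant M" using closed_shift_invariant_image by blast
  qed
qed

end
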